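(* Let $q=p^h$, $p$ prime, $h\ge1$, and $n/2\le k\le n-1$. If $v$ is the incidence vector of a small linear $k$-blocking set of $PG(n,q)$ that is non-trivial (contains no $k$-dimensional subspace), then $v\notin C_k(n,q)$.
   Context: $C_k(n,q)$ is the $p$-ary linear code spanned over $\mathbb{F}_p$ by the rows of the incidence matrix of $k$-dimensional subspaces versus points of $PG(n,q)$ (entry $1$ iff the point lies in the subspace). Field reduction: points of $PG(n,p^h)$ correspond to the elements of the Desarguesian $(h-1)$-spread $\mathcal{D}$ of $PG(h(n+1)-1,p)$ obtained by viewing $1$-dimensional $\mathbb{F}_{p^h}$-subspaces of $\mathbb{F}_{p^h}^{n+1}$ as $h$-dimensional $\mathbb{F}_p$-subspaces of $\mathbb{F}_p^{h(n+1)}$. For $U\subseteq PG(h(n+1)-1,p)$, $\mathcal{B}(U)$ is the set of points of $PG(n,p^h)$ whose spread elements meet $U$. A small linear $k$-blocking set is a set $\mathcal{B}(U)$ with $U$ an $hk$-dimensional projective subspace of $PG(h(n+1)-1,p)$; it meets every $(n-k)$-dimensional subspace of $PG(n,q)$. *)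

theory Defs
  imports
    "HOL-Analysis.Cartesian_Space"
    "Berlekamp_Zassenhaus.Finite_Field"
begin

text \<open>
  The space \<open>PG(n,q)\<close> is modelled on \<open>'f ^ 'd\<close>, where \<open>'f\<close> is the field of order \<open>q\<close> and
  \<open>CARD('d) = n + 1\<close>. Dimensions of the form \<open>m\<close> below are projective ones, so they correspond to
  vector space dimension \<open>m + 1\<close>.
\<close>

definition pg_subspace :: "nat \<Rightarrow> ('f::field ^ 'd::finite) set \<Rightarrow> bool" where
  "pg_subspace m W \<longleftrightarrow> vec.subspace W \<and> vec.dim W = m + 1"

typedef (overloaded) ('f, 'd) pg_point =
  "{P :: ('f::field ^ 'd::finite) set. pg_subspace 0 P}"
  morphisms line_of_point point_of_line
proof -
  have "axis undefined 1 \<noteq> (0 :: 'f ^ 'd)"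
    by (simp add: axis_eq_0_iff)
  then have "vec.dim (vec.span {axis undefined 1 :: 'f ^ 'd}) = 1"
    by simp
  then show ?thesis
    by (intro exI[of _ "vec.span {axis undefined 1}"]) (simp add: pg_subspace_def)
qed

instance pg_point :: ("{field,finite}", finite) finite
proof
  have "inj (line_of_point :: ('a, 'b) pg_point \<Rightarrow> _)"
    by (simp add: inj_def line_of_point_inject)
  then show "finite (UNIV :: ('a, 'b) pg_point set)"
    by (rule finite_imageD[rotated]) simp
qed

definition points_of :: "('f::field ^ 'd::finite) set \<Rightarrow> ('f, 'd) pg_point set" where
  "points_of W = {P. line_of_point P \<subseteq> W}"


text \<open>Codes of points and subspaces over \<open>\<F>\<^sub>p\<close>, with \<open>p = CARD('p)\<close>\<close>

definition incidence_vector ::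
    "('f::{field,finite}, 'd::finite) pg_point set \<Rightarrow> 'p::prime_card mod_ring ^ ('f, 'd) pg_point" where
  "incidence_vector S = (\<chi> P. if P \<in> S then 1 else 0)"

definition pg_code ::
    "nat \<Rightarrow> ('p::prime_card mod_ring ^ ('f::{field,finite}, 'd::finite) pg_point) set" where
  "pg_code k = vec.span {incidence_vector (points_of W) | W. pg_subspace k W}"


text \<open>
  Field reduction: the underlying vector space of \<open>PG(h(n+1)-1,p)\<close> is \<open>'f ^ 'd\<close> itself, with scalars
  restricted to \<open>\<F>\<^sub>p\<close>. The map \<open>fp_embed\<close> is a ring homomorphism (the embedding of the prime field)
  only if \<open>'f\<close> has characteristic \<open>CARD('p)\<close>.
\<close>

definition fp_embed :: "'p::prime_card mod_ring \<Rightarrow> 'f::field" where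
  "fp_embed a = of_int (to_int_mod_ring a)"

definition fp_scale :: "'p::prime_card mod_ring \<Rightarrow> 'f::field ^ 'd::finite \<Rightarrow> 'f ^ 'd" where
  "fp_scale a x = fp_embed a *s x"

definition fp_subspace :: "'p::prime_card itself \<Rightarrow> nat \<Rightarrow> ('f::field ^ 'd::finite) set \<Rightarrow> bool" where
  "fp_subspace _ m W \<longleftrightarrow>
     module.subspace (fp_scale :: 'p mod_ring \<Rightarrow> _) W \<and>
     vector_space.dim (fp_scale :: 'p mod_ring \<Rightarrow> _) W = m + 1"

definition fp_points_of ::
    "'p::prime_card itself \<Rightarrow> ('f::field ^ 'd::finite) set \<Rightarrow> ('f ^ 'd) set set" where
  "fp_points_of T W = {Q. fp_subspace T 0 Q \<and> Q \<subseteq> W}"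

definition spread_element ::
    "'p::prime_card itself \<Rightarrow> ('f::field, 'd::finite) pg_point \<Rightarrow> ('f ^ 'd) set set" where
  "spread_element T P = fp_points_of T (line_of_point P)"

definition spread_blocked ::
    "'p::prime_card itself \<Rightarrow> ('f::field ^ 'd::finite) set set \<Rightarrow> ('f, 'd) pg_point set" where
  "spread_blocked T U = {P. spread_element T P \<inter> U \<noteq> {}}"

definition small_linear_blocking_set ::
    "'p::prime_card itself \<Rightarrow> nat \<Rightarrow> nat \<Rightarrow> ('f::field, 'd::finite) pg_point set \<Rightarrow> bool" where
  "small_linear_blocking_set T h k S \<longleftrightarrow>
     (\<exists>W. fp_subspace T (h * k) W \<and> S = spread_blocked T (fp_points_of T W))"

definition nontrivial_blocking_set ::
    "nat \<Rightarrow> ('f::field, 'd::finite) pg_point set \<Rightarrow> bool" where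
  "nontrivial_blocking_set k S \<longleftrightarrow> \<not> (\<exists>W. pg_subspace k W \<and> points_of W \<subseteq> S)"


text \<open>Consistency of the field reduction: dimensions over \<open>\<F>\<^sub>p\<close> are as expected.\<close>

lemma CHAR_eq_of_CARD:
  assumes "CARD('f::{field,finite}) = CARD('p::prime_card) ^ h"
  shows "CHAR('f) = CARD('p)"
proof -
  have p: "prime CARD('p)" by (rule prime_card)
  have "prime CHAR('f)" by (rule prime_CHAR_semidom) (simp add: finite_imp_CHAR_pos)
  moreover have "CHAR('f) dvd CARD('p) ^ h"
    using CHAR_dvd_CARD[where 'a = 'f] assms by simp
  ultimately show ?thesis
    using p prime_dvd_power primes_dvd_imp_eq by blast
qed

lemma of_int_mod_CHAR: "(of_int (a mod int CHAR('f)) :: 'f::field) = of_int a"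
proof -
  have "(of_int a :: 'f) = of_int (int CHAR('f) * (a div int CHAR('f)) + a mod int CHAR('f))"
    by simp
  also have "\<dots> = of_int (a mod int CHAR('f))"
    by (simp only: of_int_add of_int_mult of_int_of_nat_eq of_nat_CHAR mult_zero_left add_0)
  finally show ?thesis by simp
qed

lemma vector_space_fp_scale:
  assumes "CARD('f::{field,finite}) = CARD('p::prime_card) ^ h"
  shows "vector_space (fp_scale :: 'p mod_ring \<Rightarrow> 'f ^ 'd::finite \<Rightarrow> _)"
proof -
  note c = CHAR_eq_of_CARD[OF assms]
  have add: "(fp_embed (a + b) :: 'f) = fp_embed a + fp_embed b" for a b :: "'p mod_ring"
    using of_int_mod_CHAR[where 'f = 'f, of "to_int_mod_ring a + to_int_mod_ring b"]
    by (simp add: fp_embed_def to_int_mod_ring_add c)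
  have mult: "(fp_embed (a * b) :: 'f) = fp_embed a * fp_embed b" for a b :: "'p mod_ring"
    using of_int_mod_CHAR[where 'f = 'f, of "to_int_mod_ring a * to_int_mod_ring b"]
    by (simp add: fp_embed_def to_int_mod_ring_mult c)
  have one: "(fp_embed (1 :: 'p mod_ring) :: 'f) = 1"
    by (simp add: fp_embed_def)
  show ?thesis
    by unfold_locales
      (simp_all add: fp_scale_def add mult one vec.scale_right_distrib vec.scale_left_distrib)
qed

lemma (in vector_space) card_subspace:
  assumes "subspace W" "finite W" "finite (UNIV :: 'a set)"
  shows "card W = CARD('a) ^ dim W"
proof -
  obtain B where B: "B \<subseteq> W" "independent B" "W \<subseteq> span B" "card B = dim W"
    using basis_exists by blast
  have fB: "finite B" using B(1) assms(2) finite_subset by blast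
  have W: "W = span B" using B assms(1) span_minimal by blast
  let ?f = "\<lambda>u. \<Sum>v\<in>B. scale (u v) v"
  have "inj_on ?f (B \<rightarrow>\<^sub>E UNIV)"
  proof (rule inj_onI)
    fix u w assume u: "u \<in> B \<rightarrow>\<^sub>E UNIV" "w \<in> B \<rightarrow>\<^sub>E UNIV" and eq: "?f u = ?f w"
    have "(\<Sum>v\<in>B. scale (u v - w v) v) = 0"
      using eq by (simp add: scale_left_diff_distrib sum_subtractf)
    then have "u v - w v = 0" if "v \<in> B" for v
      using independentD[OF B(2) fB order_refl _ that, of "\<lambda>v. u v - w v"] by simp
    then show "u = w"
      using u by (intro PiE_ext) auto
  qed
  then have "card (?f ` (B \<rightarrow>\<^sub>E UNIV)) = card (B \<rightarrow>\<^sub>E (UNIV :: 'a set))"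
    by (rule card_image)
  moreover have "?f ` (B \<rightarrow>\<^sub>E UNIV) = W"
  proof
    show "?f ` (B \<rightarrow>\<^sub>E UNIV) \<subseteq> W"
    proof (rule image_subsetI)
      fix u :: "'b \<Rightarrow> 'a"
      show "?f u \<in> W"
        unfolding W by (intro span_sum span_scale span_base)
    qed
    show "W \<subseteq> ?f ` (B \<rightarrow>\<^sub>E UNIV)"
    proof
      fix x assume "x \<in> W"
      then obtain u where "x = ?f u" using W span_finite[OF fB] by auto
      then have "x = ?f (restrict u B)" by simp
      then show "x \<in> ?f ` (B \<rightarrow>\<^sub>E UNIV)"
        by (rule image_eqI[where x = "restrict u B"]) (rule restrict_PiE_iff[THEN iffD2], simp)
    qed
  qed
  ultimately have "card W = card (B \<rightarrow>\<^sub>E (UNIV :: 'a set))"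
    by simp
  then show ?thesis using fB B(4) by (simp add: card_PiE)
qed

lemma dim_fp_scale:
  fixes W :: "('f::{field,finite} ^ 'd::finite) set"
  assumes "CARD('f) = CARD('p::prime_card) ^ h" and W: "vec.subspace W"
  shows "module.subspace (fp_scale :: 'p mod_ring \<Rightarrow> _) W"
    and "vector_space.dim (fp_scale :: 'p mod_ring \<Rightarrow> _) W = h * vec.dim W"
proof -
  interpret V: vector_space "fp_scale :: 'p mod_ring \<Rightarrow> 'f ^ 'd \<Rightarrow> _"
    using assms(1) by (rule vector_space_fp_scale)
  show sub: "V.subspace W"
    using W by (auto simp: V.subspace_def vec.subspace_def fp_scale_def)
  have "CARD('p) ^ V.dim W = card W"
    using V.card_subspace[OF sub] by simp
  also have "\<dots> = CARD('p) ^ (h * vec.dim W)"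
    using vec.card_subspace[OF W] assms(1) by (simp add: power_mult)
  finally show "V.dim W = h * vec.dim W"
    using prime_gt_1_nat[OF prime_card[where 'a = 'p]] by (simp add: power_inject_exp)
qed

lemma fp_subspace_UNIV:
  assumes "CARD('f::{field,finite}) = CARD('p::prime_card) ^ h" "h \<ge> 1" "CARD('d::finite) = n + 1"
  shows "fp_subspace TYPE('p) (h * (n + 1) - 1) (UNIV :: ('f ^ 'd) set)"
  using dim_fp_scale[OF assms(1) vec.subspace_UNIV, where 'd = 'd] assms
  by (simp add: fp_subspace_def vec_dim_card card_cart_basis)

lemma fp_subspace_line_of_point:
  fixes P :: "('f::{field,finite}, 'd::finite) pg_point"
  assumes "CARD('f) = CARD('p::prime_card) ^ h" "h \<ge> 1"
  shows "fp_subspace TYPE('p) (h - 1) (line_of_point P)"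
  using dim_fp_scale[OF assms(1), of "line_of_point P"] line_of_point[of P] assms(2)
  by (simp add: fp_subspace_def pg_subspace_def)

end

theory Submission
  imports Defs
begin

text \<open>
  Let \<open>W\<close> be the \<open>\<F>\<^sub>p\<close>-space defining the blocking set, \<open>|W| = p q\<^sup>k\<close>, and let \<open>C\<close> be the union of all
  multiples \<open>c W\<close> with \<open>c\<close> a nonzero scalar. Non-triviality means that \<open>W\<close> spans at least \<open>k + 2\<close>
  dimensions. Summing a codeword over the cosets of a line spanned by \<open>a\<close> maps \<open>C\<^sub>k\<close> to \<open>C\<^sub>k\<^sub>+\<^sub>1\<close> and the
  indicator of \<open>C\<close> to that of the cone over \<open>W + \<F>\<^sub>q a\<close>; this reduces the claim to \<open>k = n - 1\<close>.

  If \<open>f\<close> is a combination of indicators of hyperplanes, then \<open>S\<^sub>v(x) = \<Sum>\<^sub>c c f(x + c v)\<close> is \<open>\<F>\<^sub>q\<close>-linear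
  in \<open>x\<close>. For \<open>f\<close> the indicator of \<open>C\<close> and \<open>v \<notin> C\<close>, the kernel \<open>K\<^sub>v\<close> of \<open>S\<^sub>v\<close> is a hyperplane missing \<open>v\<close>,
  and it contains every \<open>w \<in> W\<close> such that the line through \<open>v\<close> and \<open>w\<close> carries just one
  \<open>\<F>\<^sub>p\<close>-point of \<open>W\<close>. By double counting there are so many such \<open>w\<close> that \<open>W \<subseteq> K\<^sub>v\<close> if \<open>p\<close> is odd, against
  the span condition. If \<open>p = 2\<close> one only gets that \<open>W \<inter> K\<^sub>v\<close> has index at most 2 in \<open>W\<close>, and a contradiction
  results from comparing \<open>S\<^sub>v\<close> for different \<open>v\<close>: for \<open>v = w - b x\<close> the value \<open>S\<^sub>v(x)\<close> is a sum of
  inverses over a translate of an additive subgroup of \<open>\<F>\<^sub>q\<close>.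
\<close>

subsection \<open>Additive subgroups in characteristic p\<close>

definition add_subgroup :: "'a::ab_group_add set \<Rightarrow> bool" where
  "add_subgroup A \<longleftrightarrow> 0 \<in> A \<and> (\<forall>x\<in>A. \<forall>y\<in>A. x - y \<in> A)"

lemma add_subgroup_0: "add_subgroup A \<Longrightarrow> 0 \<in> A"
  by (simp add: add_subgroup_def)

lemma add_subgroup_diff: "add_subgroup A \<Longrightarrow> x \<in> A \<Longrightarrow> y \<in> A \<Longrightarrow> x - y \<in> A"
  by (simp add: add_subgroup_def)

lemma add_subgroup_uminus: "add_subgroup A \<Longrightarrow> x \<in> A \<Longrightarrow> - x \<in> A"
  using add_subgroup_diff[of A 0 x] add_subgroup_0[of A] by simp

lemma add_subgroup_add: "add_subgroup A \<Longrightarrow> x \<in> A \<Longrightarrow> y \<in> A \<Longrightarrow> x + y \<in> A"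
  using add_subgroup_diff[of A x "- y"] add_subgroup_uminus[of A y] by simp

lemma prime_CHAR_finite_field: "prime CHAR('f::{field,finite})"
  by (rule prime_CHAR_semidom) (simp add: finite_imp_CHAR_pos)

text \<open>Translation by an element \<open>a \<noteq> 0\<close> of \<open>A\<close> permutes \<open>A\<close>, so \<open>|A| a = 0\<close>.\<close>
lemma of_nat_card_add_subgroup:
  fixes A :: "'f::{field,finite} set"
  assumes "add_subgroup A" "A \<noteq> {0}"
  shows "of_nat (card A) = (0 :: 'f)"
proof -
  obtain a where a: "a \<in> A" "a \<noteq> 0"
    using assms add_subgroup_0[OF assms(1)] by blast
  have "(\<Sum>x\<in>A. x) = (\<Sum>x\<in>A. x + a)"
    by (rule sum.reindex_bij_witness[of _ "\<lambda>x. x + a" "\<lambda>x. x - a"])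
      (use a add_subgroup_diff[OF assms(1)] add_subgroup_add[OF assms(1)] in auto)
  then have "of_nat (card A) * a = 0"
    by (simp add: sum.distrib)
  with a show ?thesis by simp
qed

text \<open>Natural multiples of \<open>b\<close> stand for its prime-field multiples; with
  \<open>s\<close> as a parameter, both the field itself and the coordinate space are
  covered.\<close>

definition adjoin :: "('a::semiring_1 \<Rightarrow> 'b \<Rightarrow> 'b) \<Rightarrow> 'b \<Rightarrow> 'b::ab_group_add set \<Rightarrow> 'b set" where
  "adjoin s b H = {s (of_nat i) b + x | i x. x \<in> H}"

context vector_space
begin

lemma scale_of_nat_in_add_subgroup:
  assumes "add_subgroup H" "x \<in> H"
  shows "scale (of_nat i) x \<in> H"
  by (induction i)
    (use assms in \<open>auto simp: scale_left_distrib add_subgroup_0 add_subgroup_add\<close>)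

lemma adjoin_subset:
  assumes "add_subgroup A" "H \<subseteq> A" "b \<in> A"
  shows "adjoin scale b H \<subseteq> A"
  using assms scale_of_nat_in_add_subgroup[OF assms(1,3)] add_subgroup_add[OF assms(1)]
  by (auto simp: adjoin_def)

lemma add_subgroup_adjoin:
  assumes "add_subgroup H" "CHAR('a) > 0"
  shows "add_subgroup (adjoin scale b H)"
  unfolding add_subgroup_def
proof (intro conjI ballI)
  show "0 \<in> adjoin scale b H"
    using add_subgroup_0[OF assms(1)] unfolding adjoin_def
    by (auto intro!: exI[of _ 0] exI[of _ "0::'b"])
next
  fix u w assume "u \<in> adjoin scale b H" "w \<in> adjoin scale b H"
  then obtain i x j y where u: "u = scale (of_nat i) b + x" "x \<in> H"
    and w: "w = scale (of_nat j) b + y" "y \<in> H"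
    by (auto simp: adjoin_def)
  have "(of_nat (CHAR('a) - 1) :: 'a) = - 1"
    using assms(2) by (simp add: of_nat_diff)
  then have "u - w = scale (of_nat (i + (CHAR('a) - 1) * j)) b + (x - y)"
    by (simp add: u w scale_left_distrib scale_left_diff_distrib)
  with add_subgroup_diff[OF assms(1) u(2) w(2)] show "u - w \<in> adjoin scale b H"
    unfolding adjoin_def by blast
qed

lemma in_add_subgroup_if_multiple_in:
  assumes "add_subgroup H" "prime CHAR('a)" "scale (of_nat i) b \<in> H" "\<not> CHAR('a) dvd i"
  shows "b \<in> H"
proof -
  have "coprime i CHAR('a)"
    using assms(2,4) using prime_imp_coprime coprime_commute by blast
  then obtain m where "[i * m = 1] (mod CHAR('a))"
    using cong_solve_coprime_nat[of i "CHAR('a)"] by auto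
  then have "(of_nat (m * i) :: 'a) = of_nat 1"
    by (simp only: of_nat_eq_iff_cong_CHAR mult.commute)
  moreover have "scale (of_nat m) (scale (of_nat i) b) \<in> H"
    using assms(1,3) by (rule scale_of_nat_in_add_subgroup)
  ultimately show ?thesis
    by (simp flip: of_nat_mult)
qed

text \<open>Multipliers can be reduced modulo p, and the first p multiples of \<open>b\<close> lie
  in distinct cosets of \<open>H\<close>: a coincidence would put a nonzero multiple of
  \<open>b\<close>, hence \<open>b\<close>, into \<open>H\<close>.\<close>

lemma card_adjoin:
  assumes H: "add_subgroup H" and p: "prime CHAR('a)" and b: "b \<notin> H"
  shows "card (adjoin scale b H) = CHAR('a) * card H"
proof -
  let ?f = "\<lambda>(i, x). scale (of_nat i) b + x"
  have "inj_on ?f ({..<CHAR('a)} \<times> H)"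
  proof -
    have *: "i = j" if "i < CHAR('a)" "j < CHAR('a)" "j \<le> i" "x \<in> H" "y \<in> H"
      "scale (of_nat i) b + x = scale (of_nat j) b + y" for i j x y
    proof (rule ccontr)
      assume "i \<noteq> j"
      have "scale (of_nat (i - j)) b = y - x"
        using that by (simp add: of_nat_diff scale_left_diff_distrib algebra_simps)
      moreover have "\<not> CHAR('a) dvd i - j"
        using that \<open>i \<noteq> j\<close> by (auto dest: dvd_imp_le)
      ultimately show False
        using in_add_subgroup_if_multiple_in[OF H p] add_subgroup_diff[OF H] that b by metis
    qed
    show ?thesis
    proof (rule inj_onI, clarsimp)
      fix i j x y
      assume a: "i < CHAR('a)" "j < CHAR('a)" "x \<in> H" "y \<in> H"
        "scale (of_nat i) b + x = scale (of_nat j) b + y"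
      have "i = j"
        using *[of i j x y] *[of j i y x] a by (cases "j \<le> i") auto
      with a show "i = j \<and> x = y" by simp
    qed
  qed
  moreover have "?f ` ({..<CHAR('a)} \<times> H) = adjoin scale b H"
  proof
    show "?f ` ({..<CHAR('a)} \<times> H) \<subseteq> adjoin scale b H"
      by (auto simp: adjoin_def)
    show "adjoin scale b H \<subseteq> ?f ` ({..<CHAR('a)} \<times> H)"
    proof
      fix u assume "u \<in> adjoin scale b H"
      then obtain i x where u: "u = scale (of_nat i) b + x" "x \<in> H"
        by (auto simp: adjoin_def)
      define j where "j = i mod CHAR('a)"
      have "(of_nat i :: 'a) = of_nat j"
        by (simp add: j_def of_nat_eq_iff_cong_CHAR cong_def)
      moreover have "j < CHAR('a)"
        using p prime_gt_0_nat by (simp add: j_def)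
      ultimately show "u \<in> ?f ` ({..<CHAR('a)} \<times> H)"
        using u by (intro image_eqI[of _ _ "(j, x)"]) auto
    qed
  qed
  ultimately show ?thesis
    by (metis card_image card_cartesian_product card_lessThan)
qed

text \<open>Adjoining \<open>b\<close> to \<open>H\<close> stays inside \<open>A\<close>, so a
  proper subgroup has index at least p.\<close>

lemma card_add_subgroup_ge:
  fixes H A :: "'b set"
  assumes "add_subgroup H" "add_subgroup A" "H \<subseteq> A" "finite A" "b \<in> A - H" "prime CHAR('a)"
  shows "CHAR('a) * card H \<le> card A"
  using card_adjoin[OF assms(1,6)] adjoin_subset[OF assms(2,3)] card_mono[OF assms(4)] assms(5)
  by (metis DiffD1 DiffD2)

end

text \<open>The prime-field line of \<open>a\<close> has order p; if it is not all of
  \<open>A\<close>, the index bound adds a second factor p.\<close>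

lemma add_subgroup_field_cases:
  fixes A :: "'f::{field,finite} set"
  assumes "add_subgroup A" "a \<in> A" "a \<noteq> 0"
  shows "A = range (\<lambda>i. of_nat i * a) \<or> CHAR('f) ^ 2 \<le> card A"
proof -
  note p = prime_CHAR_finite_field[where 'f = 'f]
  have 0: "add_subgroup {0 :: 'f}" by (simp add: add_subgroup_def)
  have H: "adjoin (*) a {0} = range (\<lambda>i. of_nat i * a)"
    by (auto simp: adjoin_def)
  have cH: "card (adjoin (*) a {0}) = CHAR('f)"
    using vector_space_over_itself.card_adjoin[OF 0 p, of a] assms by simp
  have sH: "add_subgroup (adjoin (*) a {0})"
    using vector_space_over_itself.add_subgroup_adjoin[OF 0] p prime_gt_0_nat by blast
  have sub: "adjoin (*) a {0} \<subseteq> A"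
    using vector_space_over_itself.adjoin_subset[OF assms(1) _ assms(2)] add_subgroup_0[OF assms(1)] by blast
  show ?thesis
  proof (cases "A = adjoin (*) a {0}")
    case False
    then obtain b where "b \<in> A - adjoin (*) a {0}" using sub by blast
    from vector_space_over_itself.card_add_subgroup_ge[OF sH assms(1) sub _ this p] show ?thesis
      by (simp add: cH power2_eq_square)
  qed (simp add: H)
qed

lemma card_add_subgroup_field_ge:
  fixes A :: "'f::{field,finite} set"
  assumes "add_subgroup A" "a \<in> A" "a \<noteq> 0"
  shows "CHAR('f) \<le> card A"
proof -
  have 0: "add_subgroup {0 :: 'f}" by (simp add: add_subgroup_def)
  from vector_space_over_itself.card_add_subgroup_ge[OF 0 assms(1) _ _ _ prime_CHAR_finite_field, of a] assms
  show ?thesis by (simp add: add_subgroup_0)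
qed

text \<open>Logarithmic derivative: the sum is \<open>poly P c\<close> divided by the product of all
  \<open>a + c\<close>. Were it zero for every \<open>c\<close> off \<open>A\<close>, then
  \<open>P\<close>, of degree below \<open>card A\<close>, would vanish on the complement of
  \<open>A\<close>, which contains a translate of \<open>A\<close>.\<close>

lemma sum_inverse_translates_nonzero:
  fixes A :: "'f::{field,finite} set"
  assumes A: "add_subgroup A" and b: "b \<notin> A"
  obtains c where "c \<notin> A" "(\<Sum>a\<in>A. inverse (a + c)) \<noteq> 0"
proof (rule ccontr)
  assume "\<not> thesis"
  with that have z: "(\<Sum>a\<in>A. inverse (a + c)) = 0" if "c \<notin> A" for c
    using \<open>c \<notin> A\<close> by blast
  \<comment> \<open>\<open>P\<close> is the derivative of the product of all \<open>X + a\<close>.\<close>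
  define P where "P = (\<Sum>a\<in>A. \<Prod>b\<in>A - {a}. [:b, 1:])"
  have eval: "poly P c = (\<Sum>a\<in>A. \<Prod>b\<in>A - {a}. b + c)" for c
    by (simp add: P_def poly_sum poly_prod)
  have "poly P 0 = (\<Sum>a\<in>A. if a = 0 then \<Prod>b\<in>A - {0}. b else 0)"
    unfolding eval by (intro sum.cong) (use add_subgroup_0[OF A] in auto)
  also have "\<dots> = (\<Prod>b\<in>A - {0}. b)"
    using add_subgroup_0[OF A] by simp
  finally have "poly P 0 \<noteq> 0" by simp
  then have "P \<noteq> 0" by auto
  have root: "poly P c = 0" if "c \<notin> A" for c
  proof -
    have nz: "a + c \<noteq> 0" if "a \<in> A" for a
      using add_subgroup_uminus[OF A that] \<open>c \<notin> A\<close> by (metis add.inverse_inverse add_eq_0_iff)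
    have "poly P c = (\<Sum>a\<in>A. (\<Prod>b\<in>A. b + c) * inverse (a + c))"
      unfolding eval
    proof (rule sum.cong)
      fix a assume "a \<in> A"
      then have "(\<Prod>b\<in>A. b + c) = (a + c) * (\<Prod>b\<in>A - {a}. b + c)"
        by (simp add: prod.remove)
      with nz[OF \<open>a \<in> A\<close>] show "(\<Prod>b\<in>A - {a}. b + c) = (\<Prod>b\<in>A. b + c) * inverse (a + c)"
        by (simp add: field_simps)
    qed simp
    also have "\<dots> = 0"
      using z[OF that] by (simp flip: sum_distrib_left)
    finally show ?thesis .
  qed
  have deg: "degree P \<le> card A - 1"
    unfolding P_def
  proof (rule degree_sum_le)
    fix a assume "a \<in> A"
    have "degree (\<Prod>b\<in>A - {a}. [:b, 1:]) \<le> (\<Sum>b\<in>A - {a}. degree [:b, 1:])"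
      using degree_prod_sum_le[of "A - {a}" "\<lambda>b. [:b, 1:]"] by (simp add: comp_def)
    then show "degree (\<Prod>b\<in>A - {a}. [:b, 1:]) \<le> card A - 1"
      using \<open>a \<in> A\<close> by simp
  qed simp
  have "(\<lambda>a. a + b) ` A \<subseteq> - A"
    using b add_subgroup_diff[OF A] by (metis (no_types, lifting) ComplI add_diff_cancel_left' image_subsetI)
  then have "card A \<le> card (- A)"
    by (metis card_image inj_on_def add_right_cancel card_mono finite)
  also have "\<dots> \<le> card {c. poly P c = 0}"
    using root by (intro card_mono) auto
  also have "\<dots> \<le> degree P"
    using \<open>P \<noteq> 0\<close> by (rule card_poly_roots_bound)
  finally show False
    using deg add_subgroup_0[OF A] by (metis One_nat_def card_gt_0_iff diff_less empty_iff finite less_le_trans not_less zero_less_one)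
qed

subsection \<open>The scalar cone over an additive subgroup\<close>

text \<open>For an F_p-subspace \<open>W\<close> this is the blocking set on vectors: a nonzero
  vector lies here iff the point it spans is blocked.\<close>

definition scalar_cone :: "('f::{field,finite} ^ 'd::finite) set \<Rightarrow> ('f ^ 'd) set" where
  "scalar_cone W = {x. \<exists>c. c \<noteq> 0 \<and> c *s x \<in> W}"

definition add_line :: "'f::{field,finite} ^ 'd::finite \<Rightarrow> ('f ^ 'd) set \<Rightarrow> ('f ^ 'd) set" where
  "add_line a W = {x. \<exists>t. x + t *s a \<in> W}"

lemma subset_scalar_cone: "W \<subseteq> scalar_cone W"
  by (auto simp: scalar_cone_def intro!: exI[of _ 1])

lemma scalar_cone_scaleD: "c *s x \<in> W \<Longrightarrow> x \<notin> scalar_cone W \<Longrightarrow> c = 0"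
  by (auto simp: scalar_cone_def)

lemma add_subgroup_coefficients:
  fixes x :: "'f::{field,finite} ^ 'd::finite"
  assumes "add_subgroup W"
  shows "add_subgroup {c. c *s x \<in> W}"
  using assms by (auto simp: add_subgroup_def vec.scale_left_diff_distrib)

text \<open>A vector \<open>x\<close> lies in the cone iff \<open>{c. c *s x \<in> W}\<close> is a nonzero subgroup, whose order is
  then divisible by the characteristic.\<close>
lemma of_bool_scalar_cone:
  fixes W :: "('f::{field,finite} ^ 'd::finite) set"
  assumes W: "add_subgroup W"
  shows "(of_bool (x \<in> scalar_cone W) :: 'f) = - (\<Sum>c\<in>UNIV - {0}. of_bool (c *s x \<in> W))"
proof -
  let ?A = "{c. c *s x \<in> W}"
  have A: "add_subgroup ?A" by (rule add_subgroup_coefficients[OF W])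
  have "(\<Sum>c\<in>UNIV. of_bool (c *s x \<in> W)) = of_bool (0 *s x \<in> W) +
      (\<Sum>c\<in>UNIV - {0}. of_bool (c *s x \<in> W) :: 'f)"
    by (rule sum.remove) auto
  then have "(\<Sum>c\<in>UNIV - {0}. of_bool (c *s x \<in> W)) = of_nat (card ?A) - (1 :: 'f)"
    using add_subgroup_0[OF W] by simp
  moreover have "(of_nat (card ?A) :: 'f) = (if x \<in> scalar_cone W then 0 else 1)"
  proof (cases "x \<in> scalar_cone W")
    case True
    then have "?A \<noteq> {0}" by (auto simp: scalar_cone_def)
    with of_nat_card_add_subgroup[OF A] True show ?thesis by simp
  next
    case False
    then have "?A = {0}"
      using add_subgroup_0[OF W] by (auto simp: scalar_cone_def)
    with False show ?thesis by simp
  qed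
  ultimately show ?thesis by simp
qed

lemma card_scalar_cone_le:
  fixes W :: "('f::{field,finite} ^ 'd::finite) set"
  shows "card (scalar_cone W) \<le> (CARD('f) - 1) * card W"
proof -
  have "scalar_cone W \<subseteq> (\<lambda>(c, w). c *s w) ` ((UNIV - {0}) \<times> W)"
  proof
    fix x assume "x \<in> scalar_cone W"
    then obtain c where "c \<noteq> 0" "c *s x \<in> W" by (auto simp: scalar_cone_def)
    then show "x \<in> (\<lambda>(c, w). c *s w) ` ((UNIV - {0}) \<times> W)"
      by (intro image_eqI[of _ _ "(inverse c, c *s x)"]) auto
  qed
  then have "card (scalar_cone W) \<le> card ((UNIV - {0 :: 'f}) \<times> W)"
    by (meson card_image_le card_mono finite finite_imageI le_trans)
  then show ?thesis by (simp add: card_cartesian_product card_Diff_singleton)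
qed

lemma exists_notin_scalar_cone:
  fixes W :: "('f::{field,finite} ^ 'd::finite) set"
  assumes "card W = CHAR('f) * CARD('f) ^ k" "k + 2 \<le> CARD('d)"
  shows "\<exists>v. v \<notin> scalar_cone W"
proof -
  have "card (scalar_cone W) \<le> (CARD('f) - 1) * (CHAR('f) * CARD('f) ^ k)"
    using card_scalar_cone_le[of W] by (simp add: assms(1))
  also have "\<dots> \<le> (CARD('f) - 1) * (CARD('f) * CARD('f) ^ k)"
    using dvd_imp_le[OF CHAR_dvd_CARD[where 'a = 'f]] by simp
  also have "\<dots> < CARD('f) * (CARD('f) * CARD('f) ^ k)"
    by (intro mult_strict_right_mono) auto
  also have "\<dots> = CARD('f) ^ (k + 2)" by simp
  also have "\<dots> \<le> CARD('f) ^ CARD('d)"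
    using assms(2) by (intro power_increasing) (auto simp: Suc_le_eq)
  also have "\<dots> = CARD('f ^ 'd)" by simp
  finally show ?thesis by (metis UNIV_eq_I less_irrefl)
qed

text \<open>Pigeonhole: the sums \<open>c *s x + w\<close> cannot all be distinct in
  \<open>U\<close>, and a coincidence yields a nonzero multiple of \<open>x\<close> in
  \<open>W\<close>.\<close>

lemma scalar_multiple_in_add_subgroup:
  fixes W :: "('f::{field,finite} ^ 'd::finite) set"
  assumes W: "add_subgroup W" and U: "vec.subspace U" "W \<subseteq> U" "x \<in> U"
    and card: "card U < CARD('f) * card W"
  shows "x \<in> scalar_cone W"
proof -
  let ?f = "\<lambda>(c :: 'f, w). c *s x + w"
  have "?f ` (UNIV \<times> W) \<subseteq> U"
    using U by (auto intro!: vec.subspace_add vec.subspace_scale)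
  then have "card (?f ` (UNIV \<times> W)) \<le> card U"
    by (simp add: card_mono)
  then have "\<not> inj_on ?f (UNIV \<times> W)"
    using card by (auto dest: card_image simp: card_cartesian_product)
  then obtain c w c' w' where *: "c *s x + w = c' *s x + w'" "w \<in> W" "w' \<in> W" "(c, w) \<noteq> (c', w')"
    by (auto simp: inj_on_def)
  then have "(c - c') *s x = w' - w" "c \<noteq> c'"
    by (auto simp: vec.scale_left_diff_distrib algebra_simps)
  with add_subgroup_diff[OF W *(3,2)] show ?thesis
    by (auto simp: scalar_cone_def intro!: exI[of _ "c - c'"])
qed

lemma add_subgroup_add_line:
  assumes "add_subgroup W"
  shows "add_subgroup (add_line a W)"
  unfolding add_subgroup_def
proof (intro conjI ballI)
  show "0 \<in> add_line a W"
    using add_subgroup_0[OF assms] by (auto simp: add_line_def intro!: exI[of _ 0])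
next
  fix x y assume "x \<in> add_line a W" "y \<in> add_line a W"
  then obtain s t where st: "x + s *s a \<in> W" "y + t *s a \<in> W" by (auto simp: add_line_def)
  have "x - y + (s - t) *s a = (x + s *s a) - (y + t *s a)"
    by (simp add: vec.scale_left_diff_distrib)
  also have "\<dots> \<in> W" using st by (rule add_subgroup_diff[OF assms])
  finally show "x - y \<in> add_line a W" by (auto simp: add_line_def)
qed

lemma add_line_unique:
  assumes "add_subgroup W" "a \<notin> scalar_cone W" "x + s *s a \<in> W" "x + t *s a \<in> W"
  shows "s = t"
proof -
  have "(s - t) *s a = (x + s *s a) - (x + t *s a)"
    by (simp add: vec.scale_left_diff_distrib)
  also have "\<dots> \<in> W" using assms by (intro add_subgroup_diff)
  finally show ?thesis using scalar_cone_scaleD[OF _ assms(2)] by fastforce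
qed

lemma card_add_line:
  fixes a :: "'f::{field,finite} ^ 'd::finite"
  assumes W: "add_subgroup W" and a: "a \<notin> scalar_cone W"
  shows "card (add_line a W) = CARD('f) * card W"
proof -
  let ?f = "\<lambda>(c :: 'f, w). c *s a + w"
  have "inj_on ?f (UNIV \<times> W)"
  proof (rule inj_onI, clarsimp)
    fix c c' w w' assume "w \<in> W" "w' \<in> W" and eq: "c *s a + w = c' *s a + w'"
    moreover have "(c *s a + w) + (- c) *s a = w" by simp
    moreover have "(c *s a + w) + (- c') *s a = w'" unfolding eq by simp
    ultimately have "(c *s a + w) + (- c) *s a \<in> W" "(c *s a + w) + (- c') *s a \<in> W"
      by metis+
    from add_line_unique[OF W a this] eq show "c = c' \<and> w = w'" by simp
  qed
  moreover have "?f ` (UNIV \<times> W) = add_line a W"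
  proof
    show "?f ` (UNIV \<times> W) \<subseteq> add_line a W"
    proof clarify
      fix c w assume "w \<in> W"
      then show "c *s a + w \<in> add_line a W"
        by (auto simp: add_line_def intro!: exI[of _ "- c"])
    qed
    show "add_line a W \<subseteq> ?f ` (UNIV \<times> W)"
    proof
      fix x assume "x \<in> add_line a W"
      then obtain t where "x + t *s a \<in> W" by (auto simp: add_line_def)
      then show "x \<in> ?f ` (UNIV \<times> W)"
        by (intro image_eqI[of _ _ "(- t, x + t *s a)"]) auto
    qed
  qed
  ultimately show ?thesis
    by (metis card_image card_cartesian_product)
qed

text \<open>As \<open>a\<close> is off the cone, a line in direction \<open>a\<close> meets
  \<open>W\<close> at most once.\<close>

lemma sum_of_bool_line:
  fixes x :: "'f::{field,finite} ^ 'd::finite"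
  assumes "add_subgroup W" "a \<notin> scalar_cone W"
  shows "(\<Sum>t\<in>UNIV. of_bool (x + t *s a \<in> W)) = (of_bool (x \<in> add_line a W) :: 'f)"
proof (cases "x \<in> add_line a W")
  case True
  then obtain t where t: "x + t *s a \<in> W" by (auto simp: add_line_def)
  then have "{t. x + t *s a \<in> W} = {t}"
    using add_line_unique[OF assms] by blast
  with True show ?thesis by simp
next
  case False
  then show ?thesis by (auto simp: add_line_def)
qed

text \<open>Expanding the cone into its multiples \<open>c\<close> and swapping sums leaves, after
  rescaling \<open>t\<close> by \<open>c\<close>, one line sum for \<open>W\<close> per
  \<open>c\<close>.\<close>

lemma sum_scalar_cone_line:
  fixes x :: "'f::{field,finite} ^ 'd::finite"
  assumes W: "add_subgroup W" and a: "a \<notin> scalar_cone W"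
  shows "(\<Sum>t\<in>UNIV. of_bool (x + t *s a \<in> scalar_cone W)) =
    (of_bool (x \<in> scalar_cone (add_line a W)) :: 'f)"
proof -
  have *: "(\<Sum>t\<in>UNIV. of_bool (c *s (x + t *s a) \<in> W)) = (of_bool (c *s x \<in> add_line a W) :: 'f)"
    if "c \<noteq> 0" for c
  proof -
    have "(\<Sum>t\<in>UNIV. of_bool (c *s (x + t *s a) \<in> W)) =
        (\<Sum>t\<in>UNIV. of_bool (c *s x + t *s a \<in> W) :: 'f)"
      by (rule sum.reindex_bij_witness[of _ "\<lambda>t. t / c" "\<lambda>t. c * t"])
        (use that in \<open>auto simp: vec.scale_right_distrib\<close>)
    then show ?thesis by (simp add: sum_of_bool_line[OF assms])
  qed
  have "(\<Sum>t\<in>UNIV. of_bool (x + t *s a \<in> scalar_cone W)) =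
      - (\<Sum>t\<in>UNIV. \<Sum>c\<in>UNIV - {0}. of_bool (c *s (x + t *s a) \<in> W) :: 'f)"
    by (simp add: of_bool_scalar_cone[OF W] sum_negf)
  also have "\<dots> = - (\<Sum>c\<in>UNIV - {0}. \<Sum>t\<in>UNIV. of_bool (c *s (x + t *s a) \<in> W) :: 'f)"
    by (subst sum.swap) simp
  also have "\<dots> = of_bool (x \<in> scalar_cone (add_line a W))"
    by (simp add: of_bool_scalar_cone[OF add_subgroup_add_line[OF W]] * del: sum_of_bool_eq)
  finally show ?thesis .
qed

lemma of_nat_CARD_field: "(of_nat CARD('f) :: 'f::{field,finite}) = 0"
  using CHAR_dvd_CARD[where 'a = 'f] by (simp add: of_nat_eq_0_iff_char_dvd)

text \<open>Scaling by \<open>c\<close> permutes the space, so each \<open>c\<close> contributes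
  \<open>card W\<close>, which is 0. Serves to recover the value of a codeword at 0.\<close>

lemma sum_scalar_cone:
  fixes W :: "('f::{field,finite} ^ 'd::finite) set"
  assumes W: "add_subgroup W" and "(of_nat (card W) :: 'f) = 0"
  shows "(\<Sum>x\<in>UNIV. of_bool (x \<in> scalar_cone W)) = (0 :: 'f)"
proof -
  have *: "(\<Sum>x\<in>UNIV. of_bool (c *s x \<in> W)) = (0 :: 'f)" if "c \<noteq> 0" for c
  proof -
    have "(\<Sum>x\<in>UNIV. of_bool (c *s x \<in> W)) = (\<Sum>x\<in>UNIV. of_bool (x \<in> W) :: 'f)"
      by (rule sum.reindex_bij_witness[of _ "\<lambda>x. inverse c *s x" "\<lambda>x. c *s x"])
        (use that in auto)
    with assms(2) show ?thesis by simp
  qed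
  have "(\<Sum>x\<in>UNIV. of_bool (x \<in> scalar_cone W)) =
      - (\<Sum>x\<in>UNIV. \<Sum>c\<in>UNIV - {0}. of_bool (c *s x \<in> W) :: 'f)"
    by (simp add: of_bool_scalar_cone[OF W] sum_negf)
  also have "\<dots> = - (\<Sum>c\<in>UNIV - {0}. \<Sum>x\<in>UNIV. of_bool (c *s x \<in> W) :: 'f)"
    by (subst sum.swap) simp
  finally show ?thesis by (simp add: * del: sum_of_bool_eq)
qed

subsection \<open>The code of subspaces as functions on vectors\<close>

text \<open>Codewords read on vectors instead of points, with coefficients in F_q rather than F_p.
  Wider scalars only enlarge the code, so non-membership here is the stronger claim.\<close>

inductive_set subspace_code :: "nat \<Rightarrow> ('f::{field,finite} ^ 'd::finite \<Rightarrow> 'f) set"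
  for k :: nat where
  zero: "(\<lambda>x. 0) \<in> subspace_code k"
| add_indicator: "f \<in> subspace_code k \<Longrightarrow> vec.subspace U \<Longrightarrow> vec.dim U = k + 1 \<Longrightarrow>
    (\<lambda>x. c * of_bool (x \<in> U) + f x) \<in> subspace_code k"

lemma card_subspace_vec:
  fixes U :: "('f::{field,finite} ^ 'd::finite) set"
  shows "vec.subspace U \<Longrightarrow> card U = CARD('f) ^ vec.dim U"
  by (rule vec.card_subspace) auto

lemma sum_subspace_code:
  fixes f :: "'f::{field,finite} ^ 'd::finite \<Rightarrow> 'f"
  assumes "f \<in> subspace_code k"
  shows "(\<Sum>x\<in>UNIV. f x) = 0"
  using assms
  by induction (simp_all add: sum.distrib card_subspace_vec of_nat_CARD_field
      flip: sum_distrib_left)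

lemma add_subgroup_subspace: "vec.subspace U \<Longrightarrow> add_subgroup U"
  by (auto simp: add_subgroup_def vec.subspace_0 vec.subspace_diff)

lemma scalar_cone_subspace:
  assumes "vec.subspace U"
  shows "scalar_cone U = U"
proof
  show "scalar_cone U \<subseteq> U"
  proof
    fix x assume "x \<in> scalar_cone U"
    then obtain t where t: "t \<noteq> 0" "t *s x \<in> U" by (auto simp: scalar_cone_def)
    then have "inverse t *s (t *s x) \<in> U" using assms vec.subspace_scale by blast
    with t show "x \<in> U" by simp
  qed
qed (rule subset_scalar_cone)

lemma add_line_subspace:
  assumes "vec.subspace U"
  shows "add_line a U = vec.span (insert a U)"
  unfolding add_line_def vec.span_insert
  using assms by (auto simp: vec.span_eq_iff[THEN iffD2])
    (metis add.inverse_inverse vec.scale_minus_left diff_minus_eq_add)+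

text \<open>If \<open>a\<close> lies in \<open>U\<close>, the indicator is constant along
  \<open>a\<close> and its q equal values cancel; otherwise the sum is the indicator of the span of
  \<open>U\<close> and \<open>a\<close>.\<close>

lemma subspace_code_project:
  fixes f :: "'f::{field,finite} ^ 'd::finite \<Rightarrow> 'f"
  assumes "f \<in> subspace_code k"
  shows "(\<lambda>x. \<Sum>t\<in>UNIV. f (x + t *s a)) \<in> subspace_code (k + 1)"
  using assms
proof induction
  case zero
  then show ?case using subspace_code.zero by simp
next
  case (add_indicator f U c)
  note U = add_indicator.hyps(2,3)
  have sum: "(\<Sum>t\<in>UNIV. c * of_bool (x + t *s a \<in> U) + f (x + t *s a)) =
      c * (\<Sum>t\<in>UNIV. of_bool (x + t *s a \<in> U)) + (\<Sum>t\<in>UNIV. f (x + t *s a))" for x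
    by (simp add: sum.distrib sum_distrib_left)
  show ?case
  proof (cases "a \<in> U")
    case True
    have "x + t *s a \<in> U \<longleftrightarrow> x \<in> U" for x t
      using True U(1) vec.subspace_add[OF U(1)] vec.subspace_diff[OF U(1)] vec.subspace_scale[OF U(1)]
      by (metis add_diff_cancel_right')
    then have "(\<Sum>t\<in>UNIV. of_bool (x + t *s a \<in> U)) = (0 :: 'f)" for x
      by (simp add: of_nat_CARD_field)
    then show ?thesis unfolding sum using add_indicator.IH by simp
  next
    case False
    note sg = add_subgroup_subspace[OF U(1)] and line = add_line_subspace[OF U(1)]
    have cone: "a \<notin> scalar_cone U" using scalar_cone_subspace[OF U(1)] False by simp
    have "vec.dim (vec.span (insert a U)) = k + 1 + 1"
      using False U by (simp add: vec.dim_insert vec.span_eq_iff[THEN iffD2])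
    from subspace_code.add_indicator[OF add_indicator.IH vec.subspace_span this, of c]
    show ?thesis by (simp add: sum sum_of_bool_line[OF sg cone] line)
  qed
qed

section \<open>Slope sums along a fixed direction\<close>

text \<open>A first moment along \<open>v\<close>: for the indicator of a hyperplane missing
  \<open>v\<close> it is the parameter at which the line through \<open>x\<close> meets the
  hyperplane.\<close>

definition slope_sum :: "('f::{field,finite} ^ 'd::finite \<Rightarrow> 'f) \<Rightarrow> 'f ^ 'd \<Rightarrow> 'f ^ 'd \<Rightarrow> 'f" where
  "slope_sum f v x = (\<Sum>c\<in>UNIV. c * f (x + c *s v))"

lemma field_element_neq_0_1:
  assumes "CARD('f::{field,finite}) > 2"
  obtains g :: "'f::{field,finite}" where "g \<noteq> 0" "g \<noteq> 1"
proof -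
  have "\<not> (UNIV :: 'f set) \<subseteq> {0, 1}"
  proof
    assume "(UNIV :: 'f set) \<subseteq> {0, 1}"
    then have "CARD('f) \<le> card {0, 1 :: 'f}" by (intro card_mono) auto
    with assms show False by simp
  qed
  with that show thesis by auto
qed

text \<open>Multiplication by some \<open>g\<close> other than 0 and 1 permutes the field, so it
  fixes the sum.\<close>

lemma sum_UNIV_field:
  assumes "CARD('f::{field,finite}) > 2"
  shows "(\<Sum>c\<in>UNIV. c) = (0 :: 'f)"
proof -
  obtain g :: 'f where g: "g \<noteq> 0" "g \<noteq> 1" using field_element_neq_0_1[OF assms] .
  have "(\<Sum>c\<in>UNIV. c) = (\<Sum>c\<in>UNIV. g * c)"
    by (rule sum.reindex_bij_witness[of _ "\<lambda>c. g * c" "\<lambda>c. c / g"]) (use g in auto)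
  also have "\<dots> = g * (\<Sum>c\<in>UNIV. c)"
    by (simp add: sum_distrib_left)
  finally show ?thesis using g by auto
qed

lemma slope_sum_hyperplane:
  fixes U :: "('f::{field,finite} ^ 'd::finite) set"
  assumes U: "vec.subspace U" "vec.dim U + 1 = CARD('d)" and v: "v \<notin> U"
  obtains c where "x + c *s v \<in> U" "slope_sum (\<lambda>x. of_bool (x \<in> U)) v x = c"
proof -
  have sg: "add_subgroup U" by (rule add_subgroup_subspace[OF U(1)])
  have cone: "v \<notin> scalar_cone U" using scalar_cone_subspace[OF U(1)] v by simp
  have "vec.dim (add_line v U) = vec.dim (UNIV :: ('f ^ 'd) set)"
    using v U by (simp add: add_line_subspace vec.dim_insert vec.span_eq_iff[THEN iffD2] vec_dim_card card_cart_basis)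
  then have "add_line v U = UNIV"
    by (intro vec.subspace_dim_equal) (auto simp: add_line_subspace[OF U(1)])
  then have "x \<in> add_line v U" by simp
  then obtain c where c: "x + c *s v \<in> U" by (auto simp: add_line_def)
  have "slope_sum (\<lambda>x. of_bool (x \<in> U)) v x = (\<Sum>t\<in>UNIV. if t = c then c else 0)"
    unfolding slope_sum_def
  proof (rule sum.cong)
    fix t
    show "t * of_bool (x + t *s v \<in> U) = (if t = c then c else 0)"
      using add_line_unique[OF sg cone _ c, of t] c by (cases "x + t *s v \<in> U") auto
  qed simp
  with c that show thesis by simp
qed

text \<open>Induction over the code. A hyperplane containing \<open>v\<close> contributes a multiple
  of the sum of all scalars, 0 as q > 2; for the others, uniqueness of the meeting parameter
  transfers addition and scaling.\<close>

lemma slope_sum_linear: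
  fixes f :: "'f::{field,finite} ^ 'd::finite \<Rightarrow> 'f"
  assumes "f \<in> subspace_code k" and d: "CARD('d) = k + 2" and q: "CARD('f) > 2"
  shows "slope_sum f v (x + y) = slope_sum f v x + slope_sum f v y"
    and "slope_sum f v (b *s x) = b * slope_sum f v x"
proof -
  have "(\<forall>x y. slope_sum f v (x + y) = slope_sum f v x + slope_sum f v y) \<and>
      (\<forall>b x. slope_sum f v (b *s x) = b * slope_sum f v x)"
    using assms(1)
  proof induction
    case zero
    then show ?case by (simp add: slope_sum_def)
  next
    case (add_indicator f U c)
    note U = add_indicator.hyps(2,3)
    let ?S = "slope_sum (\<lambda>x. of_bool (x \<in> U)) v"
    have "(\<forall>x y. ?S (x + y) = ?S x + ?S y) \<and> (\<forall>b x. ?S (b *s x) = b * ?S x)"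
    proof (cases "v \<in> U")
      case True
      have "x + t *s v \<in> U \<longleftrightarrow> x \<in> U" for x t
        using True vec.subspace_add[OF U(1)] vec.subspace_diff[OF U(1)] vec.subspace_scale[OF U(1)]
        by (metis add_diff_cancel_right')
      then have "?S x = 0" for x
        by (simp add: slope_sum_def sum_UNIV_field[OF q] flip: sum_distrib_right)
      then show ?thesis by simp
    next
      case False
      have dim: "vec.dim U + 1 = CARD('d)" using U d by simp
      note S = slope_sum_hyperplane[OF U(1) dim False]
      have cone: "v \<notin> scalar_cone U" using scalar_cone_subspace[OF U(1)] False by simp
      have eq: "?S x = t" if "x + t *s v \<in> U" for x t
        using S[of x] add_line_unique[OF add_subgroup_subspace[OF U(1)] cone that] by metis
      have in_U: "x + ?S x *s v \<in> U" for x using S[of x] by metis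
      show ?thesis
      proof (intro conjI allI)
        fix x y
        have "(x + y) + (?S x + ?S y) *s v = (x + ?S x *s v) + (y + ?S y *s v)"
          by (simp add: vec.scale_left_distrib)
        also have "\<dots> \<in> U" by (intro vec.subspace_add[OF U(1)] in_U)
        finally show "?S (x + y) = ?S x + ?S y" by (rule eq)
      next
        fix b x
        have "b *s x + (b * ?S x) *s v = b *s (x + ?S x *s v)"
          by (simp add: vec.scale_right_distrib)
        also have "\<dots> \<in> U" by (intro vec.subspace_scale[OF U(1)] in_U)
        finally show "?S (b *s x) = b * ?S x" by (rule eq)
      qed
    qed
    moreover have "slope_sum (\<lambda>x. c * of_bool (x \<in> U) + f x) v x = c * ?S x + slope_sum f v x" for x
      by (simp add: slope_sum_def distrib_left sum.distrib sum_distrib_left mult.left_commute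
          del: sum_mult_of_bool_eq sum_of_bool_mult_eq)
    ultimately show ?case
      using add_indicator.IH by (simp add: algebra_simps)
  qed
  then show "slope_sum f v (x + y) = slope_sum f v x + slope_sum f v y"
    and "slope_sum f v (b *s x) = b * slope_sum f v x" by blast+
qed

subsection \<open>The hyperplane case\<close>

lemma double_count_multiples:
  fixes T G :: "('f::{field,finite} ^ 'd::finite) set"
  assumes "\<And>x. x \<in> T \<Longrightarrow> m \<le> card {c. c \<noteq> 0 \<and> c *s x \<in> G}"
  shows "m * card T \<le> (CARD('f) - 1) * card G"
proof -
  let ?P = "SIGMA x:T. {c. c \<noteq> 0 \<and> c *s x \<in> G}"
  let ?f = "\<lambda>(x, c). (c, c *s x)"
  have "m * card T = (\<Sum>x\<in>T. m)" by simp
  also have "\<dots> \<le> (\<Sum>x\<in>T. card {c. c \<noteq> 0 \<and> c *s x \<in> G})"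
    by (rule sum_mono) (rule assms)
  also have "\<dots> = card ?P" by (simp add: card_SigmaI)
  also have "\<dots> = card (?f ` ?P)"
    by (rule card_image[symmetric]) (auto simp: inj_on_def)
  also have "\<dots> \<le> card ((UNIV - {0 :: 'f}) \<times> G)"
    by (rule card_mono) auto
  also have "\<dots> = (CARD('f) - 1) * card G"
    by (simp add: card_cartesian_product card_Diff_singleton)
  finally show ?thesis .
qed

text \<open>The end case of the reduction, where hyperplanes generate the code. It is shown that
  \<open>W\<close> cannot span, against non-triviality; q = 2 is treated separately.\<close>

locale hyperplane_code_cone =
  fixes W :: "('f::{field,finite} ^ 'd::finite) set" and k :: nat
  assumes subgroup: "add_subgroup W"
    and card_W: "card W = CHAR('f) * CARD('f) ^ k"
    and card_d: "CARD('d) = k + 2"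
    and k_pos: "k \<ge> 1"
    and q_gt_2: "CARD('f) > 2"
    and in_code: "(\<lambda>x. of_bool (x \<in> scalar_cone W)) \<in> subspace_code k"
begin

definition S :: "'f ^ 'd \<Rightarrow> 'f ^ 'd \<Rightarrow> 'f" where
  "S v x = slope_sum (\<lambda>x. of_bool (x \<in> scalar_cone W)) v x"

definition K :: "'f ^ 'd \<Rightarrow> ('f ^ 'd) set" where
  "K v = {x. S v x = 0}"

lemma S_add: "S v (x + y) = S v x + S v y"
  unfolding S_def by (rule slope_sum_linear[OF in_code card_d q_gt_2])

lemma S_scale: "S v (b *s x) = b * S v x"
  unfolding S_def by (rule slope_sum_linear[OF in_code card_d q_gt_2])

lemma S_0: "S v 0 = 0"
  using S_scale[of v 0 0] by simp

lemma subspace_K: "vec.subspace (K v)"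
  by (simp add: vec.subspace_def K_def S_add S_scale S_0)

lemma S_diff: "S v (x - y) = S v x - S v y"
  using S_add[of v "x - y" y] by simp

lemma p_gt_1: "CHAR('f) > 1"
  using prime_CHAR_finite_field[where 'f = 'f] prime_gt_1_nat by blast

text \<open>\<open>add_line v W\<close> has p q^(k+1) elements, more than a fraction 1/q of the
  space, so the pigeonhole argument applies: every line in direction \<open>v\<close> meets the
  cone.\<close>

lemma in_scalar_cone_add_line:
  assumes "v \<notin> scalar_cone W"
  shows "x \<in> scalar_cone (add_line v W)"
proof (rule scalar_multiple_in_add_subgroup[of _ UNIV])
  have "CARD('f ^ 'd) * 1 < CARD('f ^ 'd) * CHAR('f)"
    using p_gt_1 by (intro mult_strict_left_mono) auto
  also have "\<dots> = CARD('f) * card (add_line v W)"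
    using card_add_line[OF subgroup assms] by (simp add: card_W card_d)
  finally show "CARD('f ^ 'd) < CARD('f) * card (add_line v W)" by simp
qed (auto intro: add_subgroup_add_line subgroup)

text \<open>Shifting the parameter by 1 turns \<open>S v v\<close> into \<open>S v 0\<close> minus
  the number, modulo p, of \<open>c\<close> with \<open>c *s v\<close> in the cone; projecting from
  \<open>v\<close> shows that number to be 1.\<close>

lemma S_self:
  assumes "v \<notin> scalar_cone W"
  shows "S v v = - 1"
proof -
  have "S v v = (\<Sum>c\<in>UNIV. c * of_bool (v + c *s v \<in> scalar_cone W))"
    by (simp add: S_def slope_sum_def)
  also have "\<dots> = (\<Sum>c\<in>UNIV. (c - 1) * of_bool (c *s v \<in> scalar_cone W))"
  proof (rule sum.reindex_bij_witness[of _ "\<lambda>c. c - 1" "\<lambda>c. c + 1"])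
    fix c
    have "(c + 1) *s v = v + c *s v" by (simp add: vec.scale_left_distrib)
    then show "(c + 1 - 1) * of_bool ((c + 1) *s v \<in> scalar_cone W) =
        c * of_bool (v + c *s v \<in> scalar_cone W)" by simp
  qed auto
  also have "\<dots> = S v 0 - (\<Sum>c\<in>UNIV. of_bool (0 + c *s v \<in> scalar_cone W))"
    by (simp add: S_def slope_sum_def left_diff_distrib sum_subtractf
        del: sum_of_bool_eq sum_mult_of_bool_eq sum_of_bool_mult_eq)
  also have "\<dots> = - 1"
    unfolding sum_scalar_cone_line[OF subgroup assms]
    by (simp add: S_0 in_scalar_cone_add_line[OF assms])
  finally show ?thesis .
qed

lemma card_K:
  assumes v: "v \<notin> scalar_cone W"
  shows "card (K v) = CARD('f) ^ (k + 1)"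
proof -
  let ?f = "\<lambda>(c :: 'f, x). c *s v + x"
  have "inj_on ?f (UNIV \<times> K v)"
  proof (rule inj_onI, clarsimp)
    fix c c' x x' assume x: "x \<in> K v" "x' \<in> K v" and eq: "c *s v + x = c' *s v + x'"
    then have "S v (c *s v + x) = S v (c' *s v + x')" by simp
    with x have "c = c'" by (simp add: S_add S_scale S_self[OF v] K_def)
    with eq show "c = c' \<and> x = x'" by simp
  qed
  moreover have "?f ` (UNIV \<times> K v) = UNIV"
  proof -
    have "x \<in> ?f ` (UNIV \<times> K v)" for x
      by (rule image_eqI[of _ _ "(- S v x, x + S v x *s v)"])
        (auto simp: K_def S_add S_scale S_self[OF v])
    then show ?thesis by blast
  qed
  ultimately have "CARD('f ^ 'd) = CARD('f) * card (K v)"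
    by (metis card_image card_cartesian_product)
  then show ?thesis by (simp add: card_d)
qed

text \<open>A line through \<open>v\<close> carrying a single \<open>\<F>\<^sub>p\<close>-point of \<open>W\<close> contributes only the slope \<open>0\<close> there,
  so this point lies on \<open>K v\<close>.\<close>
lemma card_coefficients_ge:
  assumes v: "v \<notin> scalar_cone W" and y: "y \<in> K v" "y \<notin> scalar_cone (W \<inter> K v)"
  shows "CHAR('f) ^ 2 \<le> card {l. l *s y \<in> add_line v W}"
proof -
  let ?A = "{l. l *s y \<in> add_line v W}"
  have A: "add_subgroup ?A"
    by (intro add_subgroup_coefficients add_subgroup_add_line subgroup)
  obtain l where l: "l \<noteq> 0" "l *s y \<in> add_line v W"
    using in_scalar_cone_add_line[OF v, of y] by (auto simp: scalar_cone_def)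
  then obtain t where t: "l *s y + t *s v \<in> W" by (auto simp: add_line_def)
  have "?A \<noteq> range (\<lambda>i. of_nat i * l)"
  proof
    assume A_eq: "?A = range (\<lambda>i. of_nat i * l)"
    define w where "w = l *s y + t *s v"
    \<comment> \<open>If the coefficients form a single prime-field line, any \<open>m\<close>
      bringing \<open>w + c *s v\<close> into \<open>W\<close> is a natural number; then
      \<open>m *s w\<close> is in \<open>W\<close> too, and uniqueness forces
      \<open>c = 0\<close>.\<close>
    have "c * of_bool (w + c *s v \<in> scalar_cone W) = 0" for c
    proof (cases "w + c *s v \<in> scalar_cone W")
      case True
      then obtain m where m: "m \<noteq> 0" "m *s (w + c *s v) \<in> W" by (auto simp: scalar_cone_def)
      have "m *s (w + c *s v) = (m * l) *s y + (m * t + m * c) *s v"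
        by (simp add: w_def algebra_simps vec.scale_left_distrib vec.scale_right_distrib)
      with m have "m * l \<in> ?A" by (auto simp: add_line_def)
      then obtain i where "m = of_nat i" using l by (auto simp: A_eq)
      then have "m *s w \<in> W"
        using vec.scale_of_nat_in_add_subgroup[OF subgroup t] by (simp add: w_def)
      then have "m *s w + 0 *s v \<in> W" by simp
      moreover have "m *s w + (m * c) *s v \<in> W"
        using m by (simp add: vec.scale_right_distrib)
      ultimately have "m * c = 0"
        using add_line_unique[OF subgroup v] by blast
      with m show ?thesis by simp
    qed simp
    then have "S v w = 0"
      unfolding S_def slope_sum_def by (intro sum.neutral) blast
    moreover have "S v w = - t"
      using y(1) by (simp add: w_def S_add S_scale S_self[OF v] K_def)
    ultimately have "l *s y \<in> W" using t by simp
    moreover have "l *s y \<in> K v" using y(1) by (simp add: K_def S_scale)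
    ultimately show False using y(2) l by (auto simp: scalar_cone_def)
  qed
  moreover have "l \<in> ?A" using l by simp
  ultimately show ?thesis
    using add_subgroup_field_cases[OF A _ l(1)] by blast
qed

section \<open>Double counting on the hyperplane \<open>K v\<close>\<close>

lemma add_subgroup_W_K: "add_subgroup (W \<inter> K v)"
  using subgroup add_subgroup_subspace[OF subspace_K] by (auto simp: add_subgroup_def)

text \<open>Each vector counted on the left has at least p^2 - 1 nonzero multiples in the projection
  of \<open>W - K v\<close> from \<open>v\<close>.\<close>

lemma count_outside:
  assumes v: "v \<notin> scalar_cone W"
  shows "(CHAR('f) ^ 2 - 1) * card (K v - scalar_cone (W \<inter> K v)) \<le>
    (CARD('f) - 1) * (card W - card (W \<inter> K v))"
proof -
  \<comment> \<open>As \<open>S v v = - 1\<close>, this projects \<open>w\<close> to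
    \<open>K v\<close> along \<open>v\<close>.\<close>
  define G where "G = (\<lambda>w. w + S v w *s v) ` (W - K v)"
  have "(CHAR('f) ^ 2 - 1) * card (K v - scalar_cone (W \<inter> K v)) \<le> (CARD('f) - 1) * card G"
  proof (rule double_count_multiples)
    fix y assume y: "y \<in> K v - scalar_cone (W \<inter> K v)"
    let ?A = "{l. l *s y \<in> add_line v W}"
    have "?A - {0} \<subseteq> {c. c \<noteq> 0 \<and> c *s y \<in> G}"
    proof clarify
      fix l assume l: "l \<noteq> 0" "l *s y \<in> add_line v W"
      then obtain t where t: "l *s y + t *s v \<in> W" by (auto simp: add_line_def)
      have Sw: "S v (l *s y + t *s v) = - t"
        using y by (simp add: S_add S_scale S_self[OF v] K_def)
      have "t \<noteq> 0"
      proof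
        assume "t = 0"
        with t have "l *s y \<in> W \<inter> K v" using y by (simp add: K_def S_scale)
        with y l show False by (auto simp: scalar_cone_def)
      qed
      then have "l *s y + t *s v \<in> W - K v" using t Sw by (simp add: K_def)
      then show "l *s y \<in> G"
        unfolding G_def by (rule rev_image_eqI) (simp add: Sw)
    qed
    then have "card (?A - {0}) \<le> card {c. c \<noteq> 0 \<and> c *s y \<in> G}"
      by (intro card_mono) auto
    moreover have "0 \<in> ?A"
      using add_subgroup_0[OF add_subgroup_add_line[OF subgroup]] by simp
    ultimately show "CHAR('f) ^ 2 - 1 \<le> card {c. c \<noteq> 0 \<and> c *s y \<in> G}"
      using card_coefficients_ge[OF v, of y] y by (simp add: card_Diff_singleton)
  qed
  also have "card G \<le> card (W - K v)"
    unfolding G_def by (rule card_image_le) simp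
  also have "card (W - K v) = card W - card (W \<inter> K v)"
    by (simp add: card_Diff_subset_Int)
  finally show ?thesis by simp
qed

text \<open>Here the coefficients form a nonzero subgroup, which guarantees only p - 1 nonzero
  multiples.\<close>

lemma count_inside:
  "(CHAR('f) - 1) * card (scalar_cone (W \<inter> K v) - {0}) \<le> (CARD('f) - 1) * (card (W \<inter> K v) - 1)"
proof -
  have "(CHAR('f) - 1) * card (scalar_cone (W \<inter> K v) - {0}) \<le>
      (CARD('f) - 1) * card (W \<inter> K v - {0})"
  proof (rule double_count_multiples)
    fix x assume x: "x \<in> scalar_cone (W \<inter> K v) - {0}"
    let ?A = "{l. l *s x \<in> W \<inter> K v}"
    have A: "add_subgroup ?A" by (rule add_subgroup_coefficients[OF add_subgroup_W_K])
    obtain l where "l \<noteq> 0" "l \<in> ?A" using x by (auto simp: scalar_cone_def)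
    with card_add_subgroup_field_ge[OF A] have "CHAR('f) \<le> card ?A" by blast
    then have "CHAR('f) - 1 \<le> card (?A - {0})"
      using add_subgroup_0[OF A] by (simp add: card_Diff_singleton)
    also have "?A - {0} = {c. c \<noteq> 0 \<and> c *s x \<in> W \<inter> K v - {0}}"
      using x by auto
    finally show "CHAR('f) - 1 \<le> card {c. c \<noteq> 0 \<and> c *s x \<in> W \<inter> K v - {0}}" .
  qed
  then show ?thesis
    using add_subgroup_0[OF add_subgroup_W_K] by (simp add: card_Diff_singleton)
qed

text \<open>The two counts share out the nonzero vectors of \<open>K v\<close>; adding p + 1 times
  the inside count to the outside one cancels the unknown cone size.\<close>

lemma card_W_K_lower:
  assumes v: "v \<notin> scalar_cone W"
  shows "(int CHAR('f) ^ 2 - 1) * (int CARD('f) ^ k + 1) \<le>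
    int CHAR('f) * int CARD('f) ^ k + int CHAR('f) * int (card (W \<inter> K v)) - int CHAR('f) - 1"
proof -
  define p q Q r c where pq: "p = int CHAR('f)" "q = int CARD('f)" "Q = int CARD('f) ^ k"
    "r = int (card (W \<inter> K v))" "c = int (card (scalar_cone (W \<inter> K v) - {0}))"
  have p: "p > 1" and q: "q > 1" using p_gt_1 q_gt_2 by (simp_all add: pq)
  have Q: "q \<le> Q" using k_pos q self_le_power[of q k] by (simp add: pq)
  have cone: "scalar_cone (W \<inter> K v) \<subseteq> K v"
    using scalar_cone_subspace[OF subspace_K, of v] by (auto simp: scalar_cone_def)
  have zero: "0 \<in> scalar_cone (W \<inter> K v)" "0 \<in> W \<inter> K v"
    using subset_scalar_cone add_subgroup_0[OF add_subgroup_W_K] by blast+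
  have "card (K v) = card (K v - scalar_cone (W \<inter> K v)) + (card (scalar_cone (W \<inter> K v) - {0}) + 1)"
    using card_Suc_Diff1[OF _ zero(1)] card_mono[OF _ cone] by (simp add: card_Diff_subset cone)
  then have "int (card (K v)) = int (card (K v - scalar_cone (W \<inter> K v))) + c + 1"
    by (simp add: pq)
  then have KC: "int (card (K v - scalar_cone (W \<inter> K v))) = q * Q - 1 - c"
    by (simp add: card_K[OF v] pq)
  have r1: "r \<ge> 1" using zero(2) by (auto simp: pq Suc_le_eq card_gt_0_iff)
  have "int ((CHAR('f) ^ 2 - 1) * card (K v - scalar_cone (W \<inter> K v))) \<le>
    int ((CARD('f) - 1) * (card W - card (W \<inter> K v)))"
    using count_outside[OF v] by (rule of_nat_mono)
  moreover have "card (W \<inter> K v) \<le> card W" by (rule card_mono) auto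
  ultimately have 1: "(p ^ 2 - 1) * (q * Q - 1 - c) \<le> (q - 1) * (p * Q - r)"
    using p_gt_1 q_gt_2 KC by (simp add: pq of_nat_diff card_W)
  have "int ((CHAR('f) - 1) * card (scalar_cone (W \<inter> K v) - {0})) \<le>
     int ((CARD('f) - 1) * (card (W \<inter> K v) - 1))"
    using count_inside by (rule of_nat_mono)
  then have 2: "(p - 1) * c \<le> (q - 1) * (r - 1)"
    using p_gt_1 q_gt_2 r1 by (simp add: pq of_nat_diff)
  have "(p + 1) * ((p - 1) * c) \<le> (p + 1) * ((q - 1) * (r - 1))"
    using 2 p by (intro mult_left_mono) auto
  then have "(p ^ 2 - 1) * (q * Q - 1) \<le> (q - 1) * (p * Q - r + (p + 1) * (r - 1))"
    using 1 by (simp add: algebra_simps power2_eq_square)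
  \<comment> \<open>Amounts to \<open>q \<le> Q\<close>, where \<open>k \<ge> 1\<close> enters; it
    makes q - 1 a common factor.\<close>
  moreover have "(p ^ 2 - 1) * ((q - 1) * (Q + 1)) \<le> (p ^ 2 - 1) * (q * Q - 1)"
    using p Q by (intro mult_left_mono) (auto simp: algebra_simps)
  ultimately have "(q - 1) * ((p ^ 2 - 1) * (Q + 1)) \<le> (q - 1) * (p * Q - r + (p + 1) * (r - 1))"
    by (simp add: mult.left_commute)
  then have "(p ^ 2 - 1) * (Q + 1) \<le> p * Q - r + (p + 1) * (r - 1)"
    using q by (simp add: mult_le_cancel_left)
  then show ?thesis by (simp add: pq algebra_simps)
qed

section \<open>Odd characteristic\<close>

lemma span_neq_UNIV_if_subset_K:
  assumes "v \<notin> scalar_cone W" "W \<subseteq> K v"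
  shows "vec.span W \<noteq> UNIV"
proof
  assume "vec.span W = UNIV"
  then have "v \<in> K v"
    using vec.span_minimal[OF assms(2) subspace_K] by blast
  with S_self[OF assms(1)] show False by (simp add: K_def)
qed

lemma card_W_K_upper:
  assumes "w \<in> W - K v"
  shows "card (W \<inter> K v) \<le> CARD('f) ^ k"
  using vec.card_add_subgroup_ge[OF add_subgroup_W_K subgroup _ _ _ prime_CHAR_finite_field, of v w]
    assms p_gt_1 by (simp add: card_W)

text \<open>With Q = q^k, the two bounds on \<open>W \<inter> K v\<close> would give (p^2 - 1)(Q +
  1) \<le> 2 p Q - p - 1, impossible for p \<ge> 3, while p = 2 leaves room.\<close>

lemma odd_case:
  assumes "CHAR('f) \<noteq> 2"
  shows "vec.span W \<noteq> UNIV"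
proof -
  obtain v where v: "v \<notin> scalar_cone W" using exists_notin_scalar_cone[OF card_W] card_d by auto
  have "W \<subseteq> K v"
  proof (rule ccontr)
    assume "\<not> W \<subseteq> K v"
    then obtain w where "w \<in> W - K v" by blast
    from of_nat_mono[OF card_W_K_upper[OF this], where 'a = int]
    have r: "int (card (W \<inter> K v)) \<le> int CARD('f) ^ k" by simp
    define p Q where pQ: "p = int CHAR('f)" "Q = int CARD('f) ^ k"
    have p: "p \<ge> 3" using assms p_gt_1 by (simp add: pQ)
    have Q: "Q \<ge> 0" by (simp add: pQ)
    have "(p ^ 2 - 1) * (Q + 1) \<le> p * Q + p * int (card (W \<inter> K v)) - p - 1"
      using card_W_K_lower[OF v] by (simp add: pQ)
    also have "\<dots> \<le> p * Q + p * Q - p - 1"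
      using mult_left_mono[OF r, of p] p unfolding pQ(2) by linarith
    finally have "p * ((p - 2) * Q + p + 1) \<le> Q"
      by (simp add: algebra_simps power2_eq_square)
    moreover have "Q < p * ((p - 2) * Q + p + 1)"
    proof -
      define M where "M = (p - 2) * Q"
      have "1 * Q \<le> M"
        unfolding M_def using p Q by (intro mult_right_mono) auto
      then have "0 \<le> M" "Q < 1 * (M + p + 1)" using p Q by simp_all
      note this(2)
      also have "1 * (M + p + 1) \<le> p * (M + p + 1)"
        using p \<open>0 \<le> M\<close> by (intro mult_right_mono) auto
      finally show ?thesis by (simp add: M_def)
    qed
    ultimately show False by simp
  qed
  with v show ?thesis by (rule span_neq_UNIV_if_subset_K)
qed

section \<open>Characteristic two\<close>

text \<open>Otherwise \<open>W \<inter> K v\<close> would have index at least 4 in \<open>W\<close>,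
  so at most q^k / 2 elements, against the lower bound.\<close>

lemma even_index_2:
  assumes p: "CHAR('f) = 2" and v: "v \<notin> scalar_cone W" and w: "w \<in> W - K v" "w' \<in> W - K v"
  shows "w' - w \<in> K v"
proof (rule ccontr)
  assume neg: "w' - w \<notin> K v"
  let ?H = "adjoin (*s) w (W \<inter> K v)"
  have pr: "prime CHAR('f)" by (rule prime_CHAR_finite_field)
  have H: "add_subgroup ?H"
    using vec.add_subgroup_adjoin[OF add_subgroup_W_K] p_gt_1 by simp
  have cH: "card ?H = 2 * card (W \<inter> K v)"
    using vec.card_adjoin[OF add_subgroup_W_K pr] w(1) p by simp
  have sub: "?H \<subseteq> W"
    using vec.adjoin_subset[OF subgroup] w(1) by blast
  have "w' \<notin> ?H"
  proof
    assume "w' \<in> ?H"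
    then obtain i x where ix: "w' = of_nat i *s w + x" "x \<in> W \<inter> K v"
      by (auto simp: adjoin_def)
    have "(of_nat i :: 'f) = of_nat (i mod 2)"
      by (simp add: of_nat_eq_iff_cong_CHAR cong_def p)
    then have "(of_nat i :: 'f) = 0 \<or> (of_nat i :: 'f) = 1"
      by (cases "even i") (auto simp: odd_iff_mod_2_eq_one)
    then show False using ix w neg by auto
  qed
  then have "CHAR('f) * card ?H \<le> card W"
    using vec.card_add_subgroup_ge[OF H subgroup sub _ _ pr, of w'] w(2) by simp
  then have "2 * card (W \<inter> K v) \<le> CARD('f) ^ k"
    by (simp add: cH p card_W)
  from of_nat_mono[OF this, where 'a = int]
  have "2 * int (card (W \<inter> K v)) \<le> int CARD('f) ^ k" by simp
  with card_W_K_lower[OF v] show False by (simp add: p)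
qed

lemma S_eq_if_both_nonzero:
  assumes p: "CHAR('f) = 2" and v: "v \<notin> scalar_cone W"
    and w: "w \<in> W" "w' \<in> W" "S v w \<noteq> 0" "S v w' \<noteq> 0"
  shows "S v w = S v w'"
  using even_index_2[OF p v, of w w'] w by (simp add: K_def S_diff)

lemma coefficient_cases:
  assumes p: "CHAR('f) = 2" and v: "v \<notin> scalar_cone W"
    and w: "w \<in> W" "S v w \<noteq> 0" and x: "S v x = 0" and m: "m *s w + l *s x \<in> W"
  shows "m = 0 \<or> m = 1"
  using S_eq_if_both_nonzero[OF p v m w(1)] w x by (auto simp: S_add S_scale)

text \<open>Admits \<open>w - b *s x\<close> as a new direction. A nonzero multiple in
  \<open>W\<close> would have multiplier 1, and subtracting it from \<open>w\<close> would leave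
  \<open>b *s x\<close> in \<open>W\<close>.\<close>

lemma diff_notin_scalar_cone:
  assumes p: "CHAR('f) = 2" and v: "v \<notin> scalar_cone W"
    and w: "w \<in> W" "S v w \<noteq> 0" and x: "S v x = 0" and b: "b *s x \<notin> W"
  shows "w - b *s x \<notin> scalar_cone W"
proof
  assume "w - b *s x \<in> scalar_cone W"
  then obtain m where m: "m \<noteq> 0" "m *s (w - b *s x) \<in> W" by (auto simp: scalar_cone_def)
  then have "m *s w + (- (m * b)) *s x \<in> W"
    by (simp add: vec.scale_right_diff_distrib)
  with coefficient_cases[OF p v w x] m have "w - b *s x \<in> W" by fastforce
  from add_subgroup_diff[OF subgroup w(1) this] b show False by simp
qed

text \<open>A multiplier bringing \<open>x + c *s (w - b *s x)\<close> into \<open>W\<close> must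
  give \<open>w\<close> the coefficient 1, so it is \<open>inverse c\<close>; what remains is
  \<open>(inverse c - b) *s x \<in> W\<close>, and \<open>a = inverse c - b\<close> turns
  \<open>c\<close> into \<open>inverse (a + b)\<close>.\<close>

lemma S_diff_eq_sum_inverse:
  assumes p: "CHAR('f) = 2" and v: "v \<notin> scalar_cone W"
    and w: "w \<in> W" "S v w \<noteq> 0" and x: "S v x = 0" and b: "b *s x \<notin> W"
  shows "S (w - b *s x) x = (\<Sum>a | a *s x \<in> W. inverse (a + b))"
proof -
  have iff: "x + c *s (w - b *s x) \<in> scalar_cone W \<longleftrightarrow> (inverse c - b) *s x \<in> W"
    if c: "c \<noteq> 0" for c
  proof -
    have eq: "inverse c *s (x + c *s (w - b *s x)) = w + (inverse c - b) *s x"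
      using c by (simp add: vec.scale_right_distrib vec.scale_left_diff_distrib vec.scale_right_diff_distrib)
    show ?thesis
    proof
      assume "x + c *s (w - b *s x) \<in> scalar_cone W"
      then obtain m where m: "m \<noteq> 0" "m *s (x + c *s (w - b *s x)) \<in> W"
        by (auto simp: scalar_cone_def)
      have "m *s (x + c *s (w - b *s x)) = (m * c) *s w + (m * (1 - c * b)) *s x"
        by (simp add: vec.scale_right_distrib vec.scale_left_diff_distrib
            vec.scale_right_diff_distrib right_diff_distrib)
      with coefficient_cases[OF p v w x] m c have "m * c = 1" by fastforce
      then have "m = inverse c" using c by (simp add: field_simps)
      with m eq have "w + (inverse c - b) *s x \<in> W" by simp
      from add_subgroup_diff[OF subgroup this w(1)] show "(inverse c - b) *s x \<in> W" by simp
    next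
      assume "(inverse c - b) *s x \<in> W"
      then have "inverse c *s (x + c *s (w - b *s x)) \<in> W"
        unfolding eq by (rule add_subgroup_add[OF subgroup w(1)])
      with c show "x + c *s (w - b *s x) \<in> scalar_cone W"
        unfolding scalar_cone_def by (intro CollectI exI[of _ "inverse c"]) simp
    qed
  qed
  have "S (w - b *s x) x = (\<Sum>c\<in>UNIV. if c \<noteq> 0 \<and> (inverse c - b) *s x \<in> W then c else 0)"
    unfolding S_def slope_sum_def
  proof (rule sum.cong)
    fix c
    show "c * of_bool (x + c *s (w - b *s x) \<in> scalar_cone W) =
        (if c \<noteq> 0 \<and> (inverse c - b) *s x \<in> W then c else 0)"
      by (cases "c = 0") (simp_all add: iff)
  qed simp
  also have "\<dots> = (\<Sum>c | c \<noteq> 0 \<and> (inverse c - b) *s x \<in> W. c)"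
    by (simp add: sum.If_cases)
  also have "\<dots> = (\<Sum>a | a *s x \<in> W. inverse (a + b))"
  proof (rule sum.reindex_bij_witness[of _ "\<lambda>a. inverse (a + b)" "\<lambda>c. inverse c - b"])
    fix a assume a: "a \<in> {a. a *s x \<in> W}"
    have "a + b \<noteq> 0"
    proof
      assume "a + b = 0"
      then have "b *s x = - (a *s x)"
        by (metis add.inverse_inverse add_eq_0_iff vec.scale_minus_left)
      with a b add_subgroup_uminus[OF subgroup] show False by simp
    qed
    then show "inverse (a + b) \<in> {c. c \<noteq> 0 \<and> (inverse c - b) *s x \<in> W}"
      using a by simp
  qed auto
  finally show ?thesis .
qed

text \<open>The common kernel \<open>X\<close> of all \<open>S v\<close> lies in \<open>W\<close>,
  while \<open>W\<close> lies in the span of \<open>X\<close> and one further vector. If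
  \<open>W\<close> spans, \<open>X\<close> has dimension at least k + 1, hence at least q^(k+1)
  elements, more than the 2 q^k of \<open>W\<close>.\<close>

lemma even_case:
  assumes p: "CHAR('f) = 2"
  shows "vec.span W \<noteq> UNIV"
proof
  assume span: "vec.span W = UNIV"
  define X where "X = {x. \<forall>v. v \<notin> scalar_cone W \<longrightarrow> S v x = 0}"
  have subX: "vec.subspace X"
    by (simp add: vec.subspace_def X_def S_add S_scale S_0)
  have "(of_nat 2 :: 'f) = 0" unfolding p[symmetric] by (rule of_nat_CHAR)
  then have two: "(1 :: 'f) + 1 = 0" by simp
  have double: "y + y = 0" for y :: 'f
    using two by (metis distrib_left mult.right_neutral mult_zero_right)
  have minus: "- y = y" for y :: 'f
    using double[of y] by (simp add: add_eq_0_iff)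
  obtain v w where vw: "v \<notin> scalar_cone W" "w \<in> W" "S v w \<noteq> 0"
    using exists_notin_scalar_cone[OF card_W] card_d span_neq_UNIV_if_subset_K span
    unfolding K_def by fastforce
  \<comment> \<open>For \<open>x\<close> in \<open>X\<close> but not in \<open>W\<close>, 1 is not a
    coefficient, so some \<open>b\<close> makes the sum of inverses nonzero; that sum is a value
    \<open>S (w - b *s x) x\<close>, which must vanish.\<close>
  have "X \<subseteq> W"
  proof
    fix x assume x: "x \<in> X"
    show "x \<in> W"
    proof (rule ccontr)
      assume "x \<notin> W"
      then have "1 \<notin> {a. a *s x \<in> W}" by simp
      then obtain b where b: "b \<notin> {a. a *s x \<in> W}" "(\<Sum>a | a *s x \<in> W. inverse (a + b)) \<noteq> 0"
        using sum_inverse_translates_nonzero[OF add_subgroup_coefficients[OF subgroup]] by metis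
      have "S v x = 0" using x vw by (simp add: X_def)
      with vw b p have "S (w - b *s x) x \<noteq> 0" "w - b *s x \<notin> scalar_cone W"
        using S_diff_eq_sum_inverse[of v w x b] diff_notin_scalar_cone[of v w x b] by auto
      with x show False by (simp add: X_def)
    qed
  qed
  have weight_1: "l = 0 \<or> l = 1" if x: "x \<in> W" "x \<notin> X" "l *s x \<in> W" for x l
  proof -
    obtain v where "v \<notin> scalar_cone W" "S v x \<noteq> 0" using x by (auto simp: X_def)
    with S_eq_if_both_nonzero[OF p, of v "l *s x" x] x show ?thesis by (auto simp: S_scale)
  qed
  \<comment> \<open>In direction \<open>w - b *s x\<close>, the coefficient set {0, 1} gives
    explicit nonzero values at \<open>x\<close> and \<open>w\<close>; their equality forces b^2 = 1,
    that is b = 1.\<close>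
  have secant: False if v: "v \<notin> scalar_cone W" and w: "w \<in> W" "S v w \<noteq> 0"
    and x: "x \<in> W" "x \<notin> X" "S v x = 0" for v w x
  proof -
    obtain b :: 'f where b: "b \<noteq> 0" "b \<noteq> 1" using field_element_neq_0_1[OF q_gt_2] .
    then have bW: "b *s x \<notin> W" using weight_1 x by blast
    have b1: "1 + b \<noteq> 0" using b minus by (metis add_eq_0_iff)
    let ?v = "w - b *s x"
    have v': "?v \<notin> scalar_cone W" by (rule diff_notin_scalar_cone[OF p v w x(3) bW])
    have "{a. a *s x \<in> W} = {0, 1}"
      using weight_1[OF x(1,2)] x(1) add_subgroup_0[OF subgroup] by auto
    then have "S ?v x = inverse b + inverse (1 + b)"
      by (simp add: S_diff_eq_sum_inverse[OF p v w x(3) bW])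
    also have "\<dots> = (1 + (b + b)) / (b * (1 + b))"
      using b b1 by (simp add: field_simps)
    finally have Sx: "S ?v x = 1 / (b * (1 + b))" by (simp only: double add_0_right)
    have "S ?v w = b * S ?v x - 1"
      using S_self[OF v'] S_diff[of ?v w "b *s x"] by (simp add: S_scale algebra_simps)
    also have "b * S ?v x = 1 / (1 + b)"
      using b by (simp add: Sx)
    also have "1 / (1 + b) - 1 = - b / (1 + b)"
      using b1 by (simp add: field_simps)
    finally have Sw: "S ?v w = - b / (1 + b)" .
    have "S ?v w = S ?v x"
      using S_eq_if_both_nonzero[OF p v' w(1) x(1)] Sx Sw b b1 by simp
    then have "b * (b * (1 + b)) = 1 * (1 + b)"
      unfolding Sx Sw minus using b b1 by (subst (asm) frac_eq_eq) auto
    then have "b * b = 1"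
      using b1 by (metis mult.assoc mult_right_cancel)
    then have "(b - 1) * (b + 1) = 0" by (simp add: algebra_simps)
    with b b1 show False by (simp add: add.commute)
  qed
  \<comment> \<open>In characteristic 2 a nonzero \<open>S v w + S v x\<close> means different
    values, so exactly one of them is 0, which \<open>secant\<close> excludes.\<close>
  have sum_in_X: "w + x \<in> X" if wx: "w \<in> W" "w \<notin> X" "x \<in> W" "x \<notin> X" for w x
  proof (rule ccontr)
    assume "w + x \<notin> X"
    then obtain v where v: "v \<notin> scalar_cone W" "S v w + S v x \<noteq> 0" by (auto simp: X_def S_add)
    then have "S v w \<noteq> S v x" using double by auto
    with S_eq_if_both_nonzero[OF p v(1)] wx have "S v w = 0 \<or> S v x = 0" by blast
    with secant[OF v(1)] v(2) wx show False by auto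
  qed
  have "w \<notin> X" using vw by (auto simp: X_def)
  have "W \<subseteq> vec.span (insert w X)"
  proof
    fix x assume "x \<in> W"
    show "x \<in> vec.span (insert w X)"
    proof (cases "x \<in> X")
      case False
      then have "w + x \<in> vec.span (insert w X)"
        using sum_in_X vw \<open>w \<notin> X\<close> \<open>x \<in> W\<close> by (intro vec.span_base) auto
      moreover have "w \<in> vec.span (insert w X)" by (rule vec.span_base) simp
      ultimately have "w + x - w \<in> vec.span (insert w X)" by (rule vec.span_diff)
      then show ?thesis by simp
    qed (simp add: vec.span_base)
  qed
  then have "vec.span (insert w X) = UNIV"
    using span vec.span_minimal[OF _ vec.subspace_span] by blast
  then have "vec.dim (insert w X) = CARD('d)"
    by (metis vec.dim_span vec_dim_card card_cart_basis)
  then have "k + 1 \<le> vec.dim X"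
    using card_d vec.dim_insert[of w X] by (auto split: if_splits)
  then have "CARD('f) ^ (k + 1) \<le> CARD('f) ^ vec.dim X"
    using q_gt_2 by (intro power_increasing) auto
  also have "\<dots> = card X" by (rule card_subspace_vec[OF subX, symmetric])
  also have "\<dots> \<le> card W" using \<open>X \<subseteq> W\<close> by (simp add: card_mono)
  also have "\<dots> = 2 * CARD('f) ^ k" by (simp add: card_W p)
  also have "\<dots> < CARD('f) ^ (k + 1)" using q_gt_2 by simp
  finally show False by simp
qed

lemma span_neq_UNIV: "vec.span W \<noteq> UNIV"
  using odd_case even_case by blast

end

subsection \<open>Reduction to hyperplanes\<close>

lemma dim_UNIV_vec: "vec.dim (UNIV :: ('f::field ^ 'd::finite) set) = CARD('d)"
  by (simp add: vec_dim_card card_cart_basis)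

lemma span_eq_UNIV_if_dim:
  fixes W :: "('f::field ^ 'd::finite) set"
  assumes "CARD('d) \<le> vec.dim W"
  shows "vec.span W = UNIV"
  using assms by (intro vec.subspace_dim_equal) (auto simp: card_cart_basis)

text \<open>If \<open>W\<close> spans, its dimension is already large enough and any point off the
  cone serves; otherwise a point off the span raises the dimension by one.\<close>

lemma exists_projection_point:
  fixes W :: "('f::{field,finite} ^ 'd::finite) set"
  assumes W: "add_subgroup W" and card_W: "card W = CHAR('f) * CARD('f) ^ k"
    and d: "k + 2 < CARD('d)" and dim: "k + 2 \<le> vec.dim W"
  obtains a where "a \<notin> scalar_cone W" "k + 3 \<le> vec.dim (add_line a W)"
proof (cases "vec.span W = UNIV")
  case True
  obtain a where a: "a \<notin> scalar_cone W"
    using exists_notin_scalar_cone[OF card_W] d by auto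
  have "vec.dim W = CARD('d)"
    using True by (metis vec.dim_span dim_UNIV_vec)
  moreover have "W \<subseteq> add_line a W"
    by (auto simp: add_line_def intro!: exI[of _ 0])
  ultimately have "k + 3 \<le> vec.dim (add_line a W)"
    using d vec.dim_subset[of W "add_line a W"] by simp
  with a show ?thesis by (rule that)
next
  case False
  then obtain a where a: "a \<notin> vec.span W" by blast
  have "a \<notin> scalar_cone W"
  proof
    assume "a \<in> scalar_cone W"
    then have "a \<in> scalar_cone (vec.span W)"
      using vec.span_base by (auto simp: scalar_cone_def)
    with a show False by (simp add: scalar_cone_subspace)
  qed
  moreover have "insert a W \<subseteq> add_line a W"
  proof -
    have "a + (- 1) *s a \<in> W" using add_subgroup_0[OF W] by simp
    moreover have "w + 0 *s a \<in> W" if "w \<in> W" for w using that by simp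
    ultimately show ?thesis unfolding add_line_def by blast
  qed
  then have "vec.dim (insert a W) \<le> vec.dim (add_line a W)" by (rule vec.dim_subset)
  then have "k + 3 \<le> vec.dim (add_line a W)"
    using a dim by (simp add: vec.dim_insert)
  ultimately show ?thesis by (rule that)
qed

text \<open>Induction on the codimension: projecting from a suitable point raises k by one and keeps
  the hypotheses, until hyperplanes are reached.\<close>

lemma scalar_cone_notin_subspace_code:
  fixes W :: "('f::{field,finite} ^ 'd::finite) set"
  assumes "add_subgroup W" "card W = CHAR('f) * CARD('f) ^ k" "k \<ge> 1"
    and "k + 2 \<le> CARD('d)" "k + 2 \<le> vec.dim W"
  shows "(\<lambda>x. of_bool (x \<in> scalar_cone W)) \<notin> subspace_code k"
proof (cases "CARD('f) > 2")
  case True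
  from assms show ?thesis
  proof (induction "CARD('d) - (k + 2)" arbitrary: k W)
    case 0
    show ?case
    proof
      assume "(\<lambda>x. of_bool (x \<in> scalar_cone W)) \<in> subspace_code k"
      with 0 True interpret hyperplane_code_cone W k by unfold_locales auto
      show False using span_neq_UNIV span_eq_UNIV_if_dim[of W] 0 by simp
    qed
  next
    case (Suc m)
    have d: "k + 2 < CARD('d)" using Suc.hyps(2) by simp
    obtain a where a: "a \<notin> scalar_cone W" "k + 3 \<le> vec.dim (add_line a W)"
      using exists_projection_point[OF Suc.prems(1,2) d Suc.prems(5)] .
    have "(\<lambda>x. of_bool (x \<in> scalar_cone (add_line a W))) \<notin> subspace_code (k + 1)"
    proof (rule Suc.hyps(1))
      show "card (add_line a W) = CHAR('f) * CARD('f) ^ (k + 1)"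
        using card_add_line[OF Suc.prems(1) a(1)] Suc.prems(2) by simp
    qed (use Suc.hyps(2) d a Suc.prems in \<open>auto simp: add_subgroup_add_line\<close>)
    then show ?case
      using subspace_code_project[of "\<lambda>x. of_bool (x \<in> scalar_cone W)" k a]
      by (auto simp: sum_scalar_cone_line[OF Suc.prems(1) a(1)] simp del: sum_of_bool_eq)
  qed
next
  \<comment> \<open>For q = 2 an additive subgroup is a subspace, and its order bounds the dimension
    by k + 1.\<close>
  case False
  have "card {0, 1 :: 'f} \<le> CARD('f)" by (rule card_mono) auto
  with False have q: "CARD('f) = 2" by simp
  then have "{0, 1 :: 'f} = UNIV" by (intro card_subset_eq) auto
  then have "vec.subspace W"
    using add_subgroup_0[OF assms(1)] add_subgroup_add[OF assms(1)]
    by (auto simp: vec.subspace_def) (metis UNIV_I insertE singletonD vec.scale_one vec.scale_zero_left)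
  then have "CHAR('f) * 2 ^ k = 2 ^ vec.dim W"
    using card_subspace_vec[of W] assms(2) q by simp
  moreover have "CHAR('f) \<le> 2"
    using dvd_imp_le[OF CHAR_dvd_CARD[where 'a = 'f]] q by simp
  ultimately have "(2 :: nat) ^ vec.dim W \<le> 2 ^ (k + 1)" by (metis mult_le_mono1 power_Suc Suc_eq_plus1)
  then have "vec.dim W \<le> k + 1" by (simp del: power_Suc)
  with assms(5) show ?thesis by simp
qed

subsection \<open>Translation from points to vectors\<close>

lemma exists_superspace:
  fixes W :: "('f::field ^ 'd::finite) set"
  assumes "vec.dim W \<le> m" "m \<le> CARD('d)"
  shows "\<exists>U. vec.subspace U \<and> W \<subseteq> U \<and> vec.dim U = m"
  using assms
proof (induction m rule: dec_induct)
  case base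
  show ?case by (intro exI[of _ "vec.span W"]) (auto simp: vec.span_base)
next
  case (step m)
  then obtain U where U: "vec.subspace U" "W \<subseteq> U" "vec.dim U = m" by auto
  then have "U \<noteq> UNIV" using step by (auto simp: card_cart_basis)
  then obtain a where "a \<notin> U" by blast
  with U show ?case
    by (intro exI[of _ "vec.span (insert a U)"])
      (auto simp: vec.dim_insert vec.span_base vec.span_eq_iff[THEN iffD2])
qed

lemma fp_embed_hom:
  assumes "CHAR('f::field) = CARD('p::prime_card)"
  shows "(fp_embed (a + b) :: 'f) = fp_embed a + fp_embed (b :: 'p mod_ring)"
    and "(fp_embed (a * b) :: 'f) = fp_embed a * fp_embed b"
  using of_int_mod_CHAR[where 'f = 'f, of "to_int_mod_ring a + to_int_mod_ring b"]
    of_int_mod_CHAR[where 'f = 'f, of "to_int_mod_ring a * to_int_mod_ring b"]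
  by (simp_all add: fp_embed_def to_int_mod_ring_add to_int_mod_ring_mult assms)

lemma line_of_point_of_line_span:
  "x \<noteq> 0 \<Longrightarrow> line_of_point (point_of_line (vec.span {x})) = vec.span {x}"
  by (rule point_of_line_inverse) (simp add: pg_subspace_def)

lemma pg_point_cases:
  fixes P :: "('f::field, 'd::finite) pg_point"
  obtains x where "x \<noteq> 0" "P = point_of_line (vec.span {x})"
proof -
  have P: "vec.subspace (line_of_point P)" "vec.dim (line_of_point P) = 1"
    using line_of_point[of P] by (simp_all add: pg_subspace_def)
  have "\<not> line_of_point P \<subseteq> {0}"
    using P(2) vec.dim_subset[of "line_of_point P" "{0}"] by auto
  then obtain x where x: "x \<in> line_of_point P" "x \<noteq> 0" by blast
  then have "vec.span {x} = line_of_point P"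
    using P by (intro vec.subspace_dim_equal) (auto simp: vec.span_minimal)
  with x(2) that show thesis by (metis line_of_point_inverse)
qed

lemma point_of_line_in_points_of_iff:
  assumes "x \<noteq> 0" "vec.subspace U"
  shows "point_of_line (vec.span {x}) \<in> points_of U \<longleftrightarrow> x \<in> U"
  using vec.span_base[of x "{x}"] vec.span_minimal[of "{x}" U] assms
  by (auto simp: points_of_def line_of_point_of_line_span)

text \<open>Induction over the span, moving coefficients by \<open>fp_embed\<close>. Only nonzero
  vectors are matched, since 0 spans no point.\<close>

lemma pg_code_to_subspace_code:
  fixes v :: "'p::prime_card mod_ring ^ ('f::{field,finite}, 'd::finite) pg_point"
  assumes char: "CHAR('f) = CARD('p)" and "v \<in> pg_code k"
  shows "\<exists>f \<in> subspace_code k. \<forall>x. x \<noteq> 0 \<longrightarrow> f x = (fp_embed (v $ point_of_line (vec.span {x})) :: 'f)"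
  using assms(2) unfolding pg_code_def
proof (induction rule: vec.span_induct_alt)
  case base
  then show ?case
    by (intro bexI[OF _ subspace_code.zero]) (simp add: fp_embed_def)
next
  case (step c y z)
  then obtain U where U: "y = incidence_vector (points_of U)" "pg_subspace k U" by blast
  obtain f where f: "f \<in> subspace_code k"
    "\<forall>x. x \<noteq> 0 \<longrightarrow> f x = (fp_embed (z $ point_of_line (vec.span {x})) :: 'f)"
    using step by blast
  have code: "(\<lambda>x. fp_embed c * of_bool (x \<in> U) + f x) \<in> subspace_code k"
    using U(2) f(1) by (intro subspace_code.add_indicator) (auto simp: pg_subspace_def)
  have eq: "fp_embed c * of_bool (x \<in> U) + f x =
      fp_embed ((c *s y + z) $ point_of_line (vec.span {x}))" if "x \<noteq> 0" for x
    using U(2) f(2) that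
    by (simp add: fp_embed_hom[OF char] U(1) incidence_vector_def point_of_line_in_points_of_iff
        pg_subspace_def) (simp add: fp_embed_def)
  show ?case
    by (rule bexI[OF _ code]) (use eq in blast)
qed

text \<open>An F_p-point shared by \<open>W\<close> and the line of \<open>x\<close> is spanned by a
  nonzero multiple of \<open>x\<close> lying in \<open>W\<close>.\<close>

lemma spread_blocked_iff:
  fixes W :: "('f::{field,finite} ^ 'd::finite) set"
  assumes q: "CARD('f) = CARD('p::prime_card) ^ h"
    and W: "module.subspace (fp_scale :: 'p mod_ring \<Rightarrow> _) W" and x: "x \<noteq> 0"
  shows "point_of_line (vec.span {x}) \<in> spread_blocked TYPE('p) (fp_points_of TYPE('p) W)
    \<longleftrightarrow> x \<in> scalar_cone W"
proof -
  interpret V: vector_space "fp_scale :: 'p mod_ring \<Rightarrow> 'f ^ 'd \<Rightarrow> _"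
    using q by (rule vector_space_fp_scale)
  have "point_of_line (vec.span {x}) \<in> spread_blocked TYPE('p) (fp_points_of TYPE('p) W)
    \<longleftrightarrow> (\<exists>Q. V.subspace Q \<and> V.dim Q = 1 \<and> Q \<subseteq> vec.span {x} \<and> Q \<subseteq> W)"
    using line_of_point_of_line_span[OF x]
    by (auto simp: spread_blocked_def spread_element_def fp_points_of_def fp_subspace_def)
  also have "\<dots> \<longleftrightarrow> x \<in> scalar_cone W"
  proof
    assume "\<exists>Q. V.subspace Q \<and> V.dim Q = 1 \<and> Q \<subseteq> vec.span {x} \<and> Q \<subseteq> W"
    then obtain Q where Q: "V.subspace Q" "V.dim Q = 1" "Q \<subseteq> vec.span {x}" "Q \<subseteq> W" by blast
    have "\<not> Q \<subseteq> {0}"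
    proof
      assume "Q \<subseteq> {0}"
      then have "card Q \<le> 1" using card_mono[of "{0}" Q] by simp
      moreover have "card Q = CARD('p)" using V.card_subspace[OF Q(1)] Q(2) by simp
      ultimately show False using prime_gt_1_nat[OF prime_card[where 'a = 'p]] by simp
    qed
    then obtain y where y: "y \<in> Q" "y \<noteq> 0" by blast
    with Q(3) obtain c where "y = c *s x" by (auto simp: vec.span_singleton)
    with y Q(4) show "x \<in> scalar_cone W" by (auto simp: scalar_cone_def)
  next
    assume "x \<in> scalar_cone W"
    then obtain c where c: "c \<noteq> 0" "c *s x \<in> W" by (auto simp: scalar_cone_def)
    have "c *s x \<in> vec.span {x}" by (intro vec.span_scale vec.span_base) simp
    then have "V.span {c *s x} \<subseteq> vec.span {x}"
      by (intro V.span_minimal dim_fp_scale[OF q]) auto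
    moreover have "V.span {c *s x} \<subseteq> W"
      using c W by (intro V.span_minimal) auto
    moreover have "V.dim (V.span {c *s x}) = 1"
      using c x V.dim_eq_card_independent[of "{c *s x}"] by simp
    ultimately show "\<exists>Q. V.subspace Q \<and> V.dim Q = 1 \<and> Q \<subseteq> vec.span {x} \<and> Q \<subseteq> W"
      using V.subspace_span by blast
  qed
  finally show ?thesis .
qed

theorem theorem3p20:
  fixes p h n k :: nat
    and B :: "('f::{field,finite}, 'd::finite) pg_point set"
    and v :: "'p::prime_card mod_ring ^ ('f, 'd) pg_point"
  assumes "prime p" and "CARD('p) = p" and "h \<ge> 1" and "CARD('f) = p ^ h"
    and "CARD('d) = n + 1"
    and "real n / 2 \<le> real k" and "k + 1 \<le> n"
    and "small_linear_blocking_set TYPE('p) h k B"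
    and "nontrivial_blocking_set k B"
    and "v = incidence_vector B"
  shows "v \<notin> pg_code k"
proof
  assume code: "v \<in> pg_code k"
  have q: "CARD('f) = CARD('p) ^ h" using assms by simp
  have char: "CHAR('f) = CARD('p)" by (rule CHAR_eq_of_CARD[OF q])
  interpret V: vector_space "fp_scale :: 'p mod_ring \<Rightarrow> 'f ^ 'd \<Rightarrow> _"
    using q by (rule vector_space_fp_scale)
  obtain W :: "('f ^ 'd) set" where W: "V.subspace W" "V.dim W = h * k + 1"
    and B: "B = spread_blocked TYPE('p) (fp_points_of TYPE('p) W)"
    using assms(8) by (auto simp: small_linear_blocking_set_def fp_subspace_def)
  have sg: "add_subgroup W"
    using W(1) by (auto simp: add_subgroup_def V.subspace_0 V.subspace_diff)
  have card_W: "card W = CHAR('f) * CARD('f) ^ k"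
    using V.card_subspace[OF W(1)] by (simp add: W(2) char q power_mult)
  have in_B: "point_of_line (vec.span {x}) \<in> B \<longleftrightarrow> x \<in> scalar_cone W" if "x \<noteq> 0" for x
    unfolding B by (rule spread_blocked_iff[OF q W(1) that])
  \<comment> \<open>Otherwise \<open>W\<close> lies in some \<open>U\<close> of dimension k + 1, and
    q^(k+1) < q |W| puts all of \<open>U\<close> in the cone, so \<open>B\<close> contains a
    k-space.\<close>
  have dim: "k + 2 \<le> vec.dim W"
  proof (rule ccontr)
    assume "\<not> k + 2 \<le> vec.dim W"
    then obtain U where U: "vec.subspace U" "W \<subseteq> U" "vec.dim U = k + 1"
      using exists_superspace[of W "k + 1"] assms by auto
    have "card U < CARD('f) * card W"
      using prime_gt_1_nat[OF prime_card[where 'a = 'p]]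
      by (simp add: card_subspace_vec[OF U(1)] U(3) card_W char)
    then have cone: "x \<in> scalar_cone W" if "x \<in> U" for x
      using scalar_multiple_in_add_subgroup[OF sg U(1,2) that] by simp
    have "points_of U \<subseteq> B"
    proof
      fix P assume "P \<in> points_of U"
      moreover obtain x where "x \<noteq> 0" "P = point_of_line (vec.span {x})" by (rule pg_point_cases)
      ultimately show "P \<in> B"
        using in_B point_of_line_in_points_of_iff[OF _ U(1)] cone by blast
    qed
    with U assms(9) show False by (auto simp: nontrivial_blocking_set_def pg_subspace_def)
  qed
  obtain f where f: "f \<in> subspace_code k"
    "\<forall>x. x \<noteq> 0 \<longrightarrow> f x = (fp_embed (v $ point_of_line (vec.span {x})) :: 'f)"
    using pg_code_to_subspace_code[OF char code] by blast
  have f_nz: "f x = of_bool (x \<in> scalar_cone W)" if "x \<noteq> 0" for x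
    using that f(2) in_B[OF that] by (simp add: assms(10) incidence_vector_def fp_embed_def)
  \<comment> \<open>The value at \<open>0\<close>, which the code does not see, is forced since both functions sum to \<open>0\<close>.\<close>
  have "(\<Sum>x\<in>UNIV. of_bool (x \<in> scalar_cone W)) = (0 :: 'f)"
    by (rule sum_scalar_cone[OF sg]) (simp add: card_W)
  then have "(\<Sum>x\<in>UNIV. f x - of_bool (x \<in> scalar_cone W)) = 0"
    using sum_subspace_code[OF f(1)] by (simp add: sum_subtractf del: sum_of_bool_eq)
  moreover have "(\<Sum>x\<in>UNIV. f x - of_bool (x \<in> scalar_cone W)) =
      (\<Sum>x\<in>{0}. f x - of_bool (x \<in> scalar_cone W))"
    by (rule sum.mono_neutral_right) (auto simp: f_nz)
  ultimately have "f x = of_bool (x \<in> scalar_cone W)" for x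
    using f_nz by (cases "x = 0") auto
  then have "f = (\<lambda>x. of_bool (x \<in> scalar_cone W))" by blast
  \<comment> \<open>The bounds n/2 \<le> k < n yield \<open>k \<ge> 1\<close>.\<close>
  with f(1) show False
    using scalar_cone_notin_subspace_code[OF sg card_W _ _ dim] assms by auto
qed

end
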